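(* Let $s\in(0,1)$ and $p\in(1,+\infty)$. Assume $u\in C^2_b(\mathbb R^n)$ and $x_0\in\mathbb R^n$. If $p\in(1,\frac{2}{2-s})$ assume additionally that $\nabla u(x_0)\neq 0$. Then $$(-\Delta)_p^s u(x_0)=C_3(n,s,p)\,\lim_{y\to0}\frac{E_{s,p}\big[\Phi_p(u(x_0)-u(\cdot))\big](x_0,y)}{y^{sp}},$$ where $$C_3(n,s,p)=\frac{\pi^{\frac n2}\,\Gamma\left(\frac{sp}{2}\right)}{\Gamma\left(\frac{n+sp}{2}\right)}\,C_1(n,s,p).$$
   Context: $C^2_b(\mathbb R^n)$ is the space of $C^2$ functions $\mathbb R^n\to\mathbb R$ that are bounded together with their derivatives up to order two. $\Phi_p(t)=|t|^{p-2}t$ (with $\Phi_p(0)=0$). The fractional $p$-Laplacian is defined pointwise by $$(-\Delta)_p^s u(x)=C_1(n,s,p)\,\mathrm{P.V.}\int_{\mathbb R^n}\frac{\Phi_p(u(x)-u(y))}{|x-y|^{n+sp}}\,dy,\qquad \mathrm{P.V.}\int_{\mathbb R^n}=\lim_{\varepsilon\to0^+}\int_{|x-y|>\varepsilon},$$ where $C_1(n,s,p)>0$ is a fixed constant. For a bounded continuous function $f:\mathbb R^n\to\mathbb R$, the extension operator is defined, for $x\in\mathbb R^n$ and $y>0$, by $$E_{s,p}[f](x,y)=\int_{\mathbb R^n}P(x-\xi,y)f(\xi)\,d\xi,\qquad P(x,y)=\frac{\Gamma\left(\frac{n+sp}{2}\right)}{\pi^{\frac n2}\Gamma\left(\frac{sp}{2}\right)}\,\frac{y^{sp}}{(|x|^2+y^2)^{\frac{n+sp}{2}}}.$$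 In the formula, $E_{s,p}$ acts on the function $\xi\mapsto\Phi_p(u(x_0)-u(\xi))$, and the limit is taken over $y>0$.
   Formalization: If p = 2/(2-s) and ∇u(x_0) = 0, where the principal value can diverge, the limits are taken in [-∞,∞] and only this is claimed: one exists iff the other does, and then the identity holds; in all other cases both limits exist and are finite. *)

theory Defs
  imports "HOL-Analysis.Analysis"
begin

definition C2b :: "('a::euclidean_space \<Rightarrow> real) \<Rightarrow> bool" where
  "C2b u \<longleftrightarrow> (\<exists>(u' :: 'a \<Rightarrow> 'a \<Rightarrow>\<^sub>L real) (u'' :: 'a \<Rightarrow> 'a \<Rightarrow>\<^sub>L 'a \<Rightarrow>\<^sub>L real).
     (\<forall>x. (u has_derivative blinfun_apply (u' x)) (at x)) \<and>
     (\<forall>x. (u' has_derivative blinfun_apply (u'' x)) (at x)) \<and>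
     continuous_on UNIV u'' \<and>
     bounded (range u) \<and> bounded (range u') \<and> bounded (range u''))"

definition gradient :: "('a::euclidean_space \<Rightarrow> real) \<Rightarrow> 'a \<Rightarrow> 'a" where
  "gradient u x = (THE D. GDERIV u x :> D)"

definition Phi :: "real \<Rightarrow> real \<Rightarrow> real" where
  "Phi p t = \<bar>t\<bar> powr (p - 2) * t"

text \<open>Limits of truncated integrals are taken in the extended reals, so that a principal value
  may also be infinite. It is meaningful only where \<open>pv_exists\<close> holds.\<close>

definition truncated_integral :: "('a::euclidean_space \<Rightarrow> real) \<Rightarrow> 'a \<Rightarrow> real \<Rightarrow> real" where
  "truncated_integral g x \<epsilon> = (LINT y:{y. norm (x - y) > \<epsilon>}|lborel. g y)"

definition pv_exists :: "('a::euclidean_space \<Rightarrow> real) \<Rightarrow> 'a \<Rightarrow> bool" where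
  "pv_exists g x \<longleftrightarrow> (\<exists>L::ereal. ((\<lambda>\<epsilon>. ereal (truncated_integral g x \<epsilon>)) \<longlongrightarrow> L) (at_right 0))"

definition pv_integral :: "('a::euclidean_space \<Rightarrow> real) \<Rightarrow> 'a \<Rightarrow> ereal" where
  "pv_integral g x = Lim (at_right 0) (\<lambda>\<epsilon>. ereal (truncated_integral g x \<epsilon>))"

definition frac_p_integrand ::
    "real \<Rightarrow> real \<Rightarrow> ('a::euclidean_space \<Rightarrow> real) \<Rightarrow> 'a \<Rightarrow> 'a \<Rightarrow> real" where
  "frac_p_integrand s p u x y = Phi p (u x - u y) / norm (x - y) powr (real DIM('a) + s * p)"

text \<open>The normalisation \<open>C1 n s p\<close> is an arbitrary positive constant and hence a parameter.\<close>

definition frac_p_laplacian ::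
    "(nat \<Rightarrow> real \<Rightarrow> real \<Rightarrow> real) \<Rightarrow> real \<Rightarrow> real \<Rightarrow> ('a::euclidean_space \<Rightarrow> real) \<Rightarrow> 'a \<Rightarrow> ereal" where
  "frac_p_laplacian C1 s p u x = ereal (C1 DIM('a) s p) * pv_integral (frac_p_integrand s p u x) x"

definition ext_kernel :: "real \<Rightarrow> real \<Rightarrow> 'a::euclidean_space \<Rightarrow> real \<Rightarrow> real" where
  "ext_kernel s p x y =
     Gamma ((real DIM('a) + s * p) / 2) / (pi powr (real DIM('a) / 2) * Gamma (s * p / 2)) *
     (y powr (s * p) / ((norm x)\<^sup>2 + y\<^sup>2) powr ((real DIM('a) + s * p) / 2))"

definition extension ::
    "real \<Rightarrow> real \<Rightarrow> ('a::euclidean_space \<Rightarrow> real) \<Rightarrow> 'a \<Rightarrow> real \<Rightarrow> real" where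
  "extension s p f x y = (LINT \<xi>|lborel. ext_kernel s p (x - \<xi>) y * f \<xi>)"

definition C3 :: "(nat \<Rightarrow> real \<Rightarrow> real \<Rightarrow> real) \<Rightarrow> nat \<Rightarrow> real \<Rightarrow> real \<Rightarrow> real" where
  "C3 C1 n s p =
     pi powr (real n / 2) * Gamma (s * p / 2) / Gamma ((real n + s * p) / 2) * C1 n s p"

definition extension_quotient ::
    "real \<Rightarrow> real \<Rightarrow> ('a::euclidean_space \<Rightarrow> real) \<Rightarrow> 'a \<Rightarrow> real \<Rightarrow> real" where
  "extension_quotient s p u x y = extension s p (\<lambda>\<xi>. Phi p (u x - u \<xi>)) x y / y powr (s * p)"

end

(* With g(z) = Phi p (u x0 - u (x0 + z)) and c = n + sp, the truncated integrals are
   T(r) = int over |z| > r of g(z) |z|^(-c), and the extension quotient is, up to its normalising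
   constant, Q(y) = int of g(z) (|z|^2 + y^2)^(-c/2).

   If p <> 2/(2-s) or the gradient at x0 is nonzero, a Taylor expansion shows that the even part
   of g is integrable against |z|^(-c), and dominated convergence sends T and Q to the same limit.

   In the borderline case p = 2/(2-s) with vanishing gradient, g(z) = O(|z|^(sp)) and the blow-up
   g(yw)/y^(sp) converges to a function g0 that is homogeneous of degree sp, so everything is
   scale invariant and T may diverge logarithmically. Integrating g0 against any radial weight
   gives one and the same constant C times a one-dimensional integral. Hence T(y/2) - T(y) tends to
   C log 2 and Q(y) - T(y) to a multiple of C: for C <> 0 both T and Q diverge to the infinity with
   the sign of C, and for C = 0 their difference vanishes in the limit. *)

theory Submission
  imports Defs
begin

section \<open>Change of variables and radial integrals\<close>

text \<open>The exponent \<open>2 / (2 - s)\<close> is where two scalings meet. With vanishing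
  gradient, \<open>u x0 - u (x0 + z)\<close> is quadratically small, so \<open>Phi p\<close> of it
  has size |z|^(2(p-1)), which makes up for the singularity |z|^(-n-sp) exactly when 2(p-1) > sp.
  With gradient D nonzero, the leading term \<open>Phi p\<close> of the linear part is odd and in
  general not absolutely integrable; it cancels because both kernels are radial, and what remains
  has degree p > sp. The obstacle for p < 2 is that the derivative of \<open>Phi p\<close> blows up
  at 0: the remainder carries |D . z|^(p-2), unbounded along the hyperplane orthogonal to D, yet
  integrable since p - 2 > -1. In the borderline case with C = 0 no rate of convergence of the
  blow-up is available, so the limits are only shown to exist together; hence the comparison for an
  arbitrary \<open>l :: ereal\<close>.\<close>

lemma sets_borel_cball [measurable]: "cball (x::'a::metric_space) r \<in> sets borel"
  by simp

lemma nn_integral_affine_euclidean: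
  fixes f :: "'a::euclidean_space \<Rightarrow> ennreal" and c :: real
  assumes [measurable]: "f \<in> borel_measurable borel" and c: "c \<noteq> 0"
  shows "(\<integral>\<^sup>+x. f x \<partial>lborel) = ennreal (\<bar>c\<bar> ^ DIM('a)) * (\<integral>\<^sup>+x. f (t + c *\<^sub>R x) \<partial>lborel)"
  by (subst lborel_affine[OF c, of t])
     (simp add: nn_integral_density nn_integral_distr nn_integral_cmult ennreal_power)

lemma integrable_affine_euclidean:
  fixes f :: "'a::euclidean_space \<Rightarrow> real" and c :: real
  assumes [measurable]: "f \<in> borel_measurable borel" and c: "c \<noteq> 0"
  shows "integrable lborel (\<lambda>x. f (t + c *\<^sub>R x)) \<longleftrightarrow> integrable lborel f"
  using c nn_integral_affine_euclidean[of "\<lambda>x. ennreal (norm (f x))" c t]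
  by (auto simp: integrable_iff_bounded ennreal_mult_less_top)

lemma lborel_integral_affine_euclidean:
  fixes f :: "'a::euclidean_space \<Rightarrow> real" and c :: real
  assumes [measurable]: "f \<in> borel_measurable borel" and c: "c \<noteq> 0"
  shows "(LINT x|lborel. f x) = \<bar>c\<bar> ^ DIM('a) * (LINT x|lborel. f (t + c *\<^sub>R x))"
  by (subst lborel_affine[OF c, of t])
     (simp add: integral_density integral_distr)

section \<open>Power weights on half-lines and polar coordinates for homogeneous densities\<close>

lemma nn_integral_powr_Ioc:
  fixes e r :: real
  assumes "e > 0" "r \<ge> 0"
  shows "(\<integral>\<^sup>+t. ennreal (t powr (e - 1)) * indicator {0<..r} t \<partial>lborel) = ennreal (r powr e / e)"
proof -
  have "((\<lambda>t. t powr (e - 1)) has_integral (r powr e / e)) {0..r}"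
    using has_integral_powr_from_0[of "e - 1" r] assms by simp
  then have "ennreal (r powr e / e) = (\<integral>\<^sup>+t. ennreal (t powr (e - 1)) * indicator {0..r} t \<partial>lborel)"
    by (intro nn_integral_has_integral_lebesgue'[symmetric]) auto
  also have "\<dots> = (\<integral>\<^sup>+t. ennreal (t powr (e - 1)) * indicator {0<..r} t \<partial>lborel)"
    by (intro nn_integral_cong) (auto simp: indicator_def)
  finally show ?thesis by simp
qed

lemma nn_integral_powr_Ioi:
  fixes e r :: real
  assumes "e > 0" "r > 0"
  shows "(\<integral>\<^sup>+t. ennreal (t powr (- e - 1)) * indicator {r<..} t \<partial>lborel) < \<infinity>"
proof -
  have "((\<lambda>t. t powr (- e - 1)) has_integral -(r powr (- e)) / (- e)) {r..}"
    using has_integral_powr_to_inf[of "- e - 1" r] assms by simp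
  then have "(\<integral>\<^sup>+t. ennreal (t powr (- e - 1)) * indicator {r..} t \<partial>lborel) = ennreal (-(r powr (- e)) / (- e))"
    by (intro nn_integral_has_integral_lebesgue') auto
  moreover have "(\<integral>\<^sup>+t. ennreal (t powr (- e - 1)) * indicator {r<..} t \<partial>lborel) \<le>
     (\<integral>\<^sup>+t. ennreal (t powr (- e - 1)) * indicator {r..} t \<partial>lborel)"
    by (intro nn_integral_mono) (auto simp: indicator_def)
  ultimately show ?thesis by (simp add: top.not_eq_extremum le_less_trans)
qed

text \<open>Polar coordinates without a surface measure: by scaling, both sides give the half-lines
  \<open>{..r}\<close> the same mass.\<close>

lemma distr_norm_homogeneous:
  fixes q :: "'a::euclidean_space \<Rightarrow> real"
  defines "e b \<equiv> b + real DIM('a)"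
  assumes [measurable]: "q \<in> borel_measurable borel" and nonneg: "\<And>w. 0 \<le> q w"
    and hom: "\<And>r w. r > 0 \<Longrightarrow> q (r *\<^sub>R w) = r powr b * q w"
    and pos: "0 < e b"
    and fin: "integrable lborel (\<lambda>w. indicator (cball 0 1) w * q w)"
  shows "distr (density lborel q) borel norm =
    density lborel (\<lambda>r. e b * (LINT w|lborel. indicator (cball 0 1) w * q w) * r powr (e b - 1) * indicator {0<..} r)"
    (is "?M = ?N")
proof -
  define P where "P = (LINT w|lborel. indicator (cball 0 1) w * q w)"
  have P0: "P \<ge> 0" unfolding P_def using nonneg by (intro integral_nonneg_AE) auto
  have nnP: "(\<integral>\<^sup>+w. ennreal (indicator (cball 0 1) w * q w) \<partial>lborel) = ennreal P"
    unfolding P_def using nonneg by (intro nn_integral_eq_integral fin) auto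
  have eM: "emeasure ?M {..r} = ennreal (P * r powr (e b))" if "r > 0" for r
  proof -
    have [measurable]: "norm -` {..r} \<in> sets (borel :: 'a measure)"
    proof -
      have "norm -` {..r} = cball (0::'a) r" by auto
      then show ?thesis by simp
    qed
    have "emeasure ?M {..r} = (\<integral>\<^sup>+w. ennreal (q w) * indicator (norm -` {..r}) w \<partial>lborel)"
      by (simp add: emeasure_distr emeasure_density)
    also have "\<dots> = ennreal (r ^ DIM('a)) * (\<integral>\<^sup>+w. ennreal (q (r *\<^sub>R w)) * indicator (norm -` {..r}) (r *\<^sub>R w) \<partial>lborel)"
      using that by (subst nn_integral_affine_euclidean[of _ r 0]) auto
    also have "(\<integral>\<^sup>+w. ennreal (q (r *\<^sub>R w)) * indicator (norm -` {..r}) (r *\<^sub>R w) \<partial>lborel) =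
      (\<integral>\<^sup>+w. ennreal (r powr b) * ennreal (indicator (cball 0 1) w * q w) \<partial>lborel)"
      using that nonneg by (intro nn_integral_cong) (auto simp: hom indicator_def ennreal_mult)
    also have "\<dots> = ennreal (r powr b) * ennreal P"
      by (subst nn_integral_cmult) (auto simp: nnP)
    also have "ennreal (r ^ DIM('a)) * (ennreal (r powr b) * ennreal P) = ennreal (P * r powr (e b))"
      using that P0 by (simp add: ennreal_mult[symmetric] e_def powr_add powr_realpow mult_ac)
    finally show ?thesis .
  qed
  \<comment> \<open>The density on the half-line is the derivative of P r^(e b), so its mass up to r
    is the value just found for the image measure.\<close>
  have eN: "emeasure ?N {..r} = ennreal (P * r powr (e b))" if "r \<ge> 0" for r
  proof -
    have "emeasure ?N {..r} = (\<integral>\<^sup>+t. ennreal (e b * P) * (ennreal (t powr (e b - 1)) * indicator {0<..r} t) \<partial>lborel)"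
      unfolding P_def[symmetric] using P0 pos
      by (subst emeasure_density) (auto intro!: nn_integral_cong simp: indicator_def ennreal_mult mult_ac)
    also have "\<dots> = ennreal (e b * P) * ennreal (r powr e b / e b)"
      using pos that by (subst nn_integral_cmult) (auto simp: nn_integral_powr_Ioc)
    also have "\<dots> = ennreal (P * r powr (e b))"
      using pos P0 by (simp add: ennreal_mult[symmetric])
    finally show ?thesis .
  qed
  \<comment> \<open>Rescaling to the unit ball is impossible for \<open>r \<le> 0\<close>; there the
    ball lies in the null set {0}.\<close>
  have eM0: "emeasure ?M {..r} = 0" if "r \<le> 0" for r
  proof -
    have eq: "norm -` {..r} = cball (0::'a) r" by auto
    have "cball (0::'a) r \<subseteq> {0}" using that by (auto simp: norm_le_zero_iff[symmetric] simp del: norm_le_zero_iff)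
    then have "norm -` {..r} \<in> null_sets (lborel :: 'a measure)"
      unfolding eq using null_sets_subset[of "{0::'a}" lborel] by (auto simp: finite_imp_null_set_lborel)
    then show ?thesis
      using sets_borel_cball[of "0::'a" r, folded eq]
      by (simp add: emeasure_distr emeasure_density nn_integral_null_set)
  qed
  have eN0: "emeasure ?N {..r} = 0" if "r < 0" for r
    using that by (subst emeasure_density) (auto intro!: nn_integral_0_iff_AE[THEN iffD2] AE_I2 simp: indicator_def)
  have eq: "emeasure ?M {..r} = emeasure ?N {..r}" for r
    using eM eN eM0 eN0[of r] eN[of 0] pos by (cases "r > 0"; cases "r = 0") auto
  show ?thesis
  proof (rule measure_eqI_generator_eq_countable[where E="range (\<lambda>a::real. {..a})" and \<Omega>=UNIV and A="range (\<lambda>n::nat. {..real n})"])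
    show "Int_stable (range (\<lambda>a::real. {..a}))"
      by (auto simp: Int_stable_def)
    show "sets ?M = sigma_sets UNIV (range (\<lambda>a::real. {..a}))" "sets ?N = sigma_sets UNIV (range (\<lambda>a::real. {..a}))"
      by (simp_all add: borel_eq_atMost)
    show "\<Union> (range (\<lambda>n::nat. {..real n})) = UNIV" by (auto simp: real_arch_simple)
    show "emeasure ?M a \<noteq> \<infinity>" if "a \<in> range (\<lambda>n::nat. {..real n})" for a
      using that eN by (auto simp: eq)
  qed (auto simp: eq)
qed

text \<open>The image of the density \<open>q\<close> under \<open>norm\<close> is an explicit power
  density, so integrating \<open>f (norm w)\<close> reduces to one variable. The factor
  \<open>e b\<close> times the mass of the unit ball is the integral of \<open>q\<close> over the
  unit sphere.\<close>

lemma integrable_homogeneous_radial: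
  fixes q :: "'a::euclidean_space \<Rightarrow> real" and f :: "real \<Rightarrow> real"
  defines "e b \<equiv> b + real DIM('a)"
  assumes [measurable]: "q \<in> borel_measurable borel" "f \<in> borel_measurable borel"
    and q: "\<And>w. 0 \<le> q w"
    and hom: "\<And>r w. r > 0 \<Longrightarrow> q (r *\<^sub>R w) = r powr b * q w"
    and pos: "0 < e b"
    and fin: "integrable lborel (\<lambda>w. indicator (cball 0 1) w * q w)"
    and f: "integrable lborel (\<lambda>r. indicator {0<..} r * (f r * r powr (e b - 1)))"
  shows "integrable lborel (\<lambda>w. q w * f (norm w))"
    and "(LINT w|lborel. q w * f (norm w)) =
      e b * (LINT w|lborel. indicator (cball 0 1) w * q w) *
        (LINT r|lborel. indicator {0<..} r * (f r * r powr (e b - 1)))"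
proof -
  define P where "P = (LINT w|lborel. indicator (cball 0 1) w * q w)"
  have P0: "P \<ge> 0" unfolding P_def using q by (intro integral_nonneg_AE) auto
  define h where "h = (\<lambda>r. e b * P * r powr (e b - 1) * indicator {0<..} r)"
  have h: "h \<in> borel_measurable borel" "\<And>r. 0 \<le> h r"
    unfolding h_def using P0 pos by auto
  note [measurable] = h(1)
  have eq: "distr (density lborel q) borel norm = density lborel h"
    unfolding h_def P_def using distr_norm_homogeneous[of q b] q hom pos fin unfolding e_def by auto
  have hf: "h r * f r = e b * P * (indicator {0<..} r * (f r * r powr (e b - 1)))" for r
    by (simp add: h_def)
  have "integrable (density lborel h) f"
    using h f by (subst integrable_density) (auto simp: hf)
  then show "integrable lborel (\<lambda>w. q w * f (norm w))"
    unfolding eq[symmetric] using q by (subst (asm) integrable_distr_eq) (auto simp: integrable_density)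
  have "(LINT w|lborel. q w * f (norm w)) = (LINT r|distr (density lborel q) borel norm. f r)"
    using q by (subst integral_distr) (auto simp: integral_density)
  also have "\<dots> = (LINT r|lborel. h r * f r)"
    unfolding eq using h by (subst integral_density) auto
  finally show "(LINT w|lborel. q w * f (norm w)) = e b * P * (LINT r|lborel. indicator {0<..} r * (f r * r powr (e b - 1)))"
    by (simp add: hf)
qed

lemma integrable_powr_Ioc:
  fixes e r :: real
  assumes "e > 0" "r > 0"
  shows "integrable lborel (\<lambda>t. indicator {0<..r} t * t powr (e - 1))"
proof (rule integrableI_nonneg)
  have "(\<integral>\<^sup>+t. ennreal (indicator {0<..r} t * t powr (e - 1)) \<partial>lborel) =
    (\<integral>\<^sup>+t. ennreal (t powr (e - 1)) * indicator {0<..r} t \<partial>lborel)"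
    by (intro nn_integral_cong) (auto simp: indicator_def)
  then show "(\<integral>\<^sup>+t. ennreal (indicator {0<..r} t * t powr (e - 1)) \<partial>lborel) < \<infinity>"
    using assms by (simp add: nn_integral_powr_Ioc)
qed auto

lemma integrable_powr_Ioi:
  fixes e r :: real
  assumes "e > 0" "r > 0"
  shows "integrable lborel (\<lambda>t. indicator {r<..} t * t powr (- e - 1))"
proof (rule integrableI_nonneg)
  have "(\<integral>\<^sup>+t. ennreal (indicator {r<..} t * t powr (- e - 1)) \<partial>lborel) =
    (\<integral>\<^sup>+t. ennreal (t powr (- e - 1)) * indicator {r<..} t \<partial>lborel)"
    by (intro nn_integral_cong) (auto simp: indicator_def)
  then show "(\<integral>\<^sup>+t. ennreal (indicator {r<..} t * t powr (- e - 1)) \<partial>lborel) < \<infinity>"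
    using assms nn_integral_powr_Ioi[of e r] by simp
qed auto

lemma integrable_radial:
  fixes f :: "real \<Rightarrow> real"
  assumes [measurable]: "f \<in> borel_measurable borel"
    and f: "integrable lborel (\<lambda>r. indicator {0<..} r * (f r * r powr (real DIM('a) - 1)))"
  shows "integrable lborel (\<lambda>w::'a::euclidean_space. f (norm w))"
proof -
  have "integrable lborel (\<lambda>w::'a. 1 * f (norm w))"
  proof (rule integrable_homogeneous_radial(1)[where b=0])
    show "integrable lborel (\<lambda>w::'a. indicator (cball 0 1) w * (1::real))"
      using emeasure_lborel_cball_finite[of "0::'a" 1]
      by (simp add: integrable_indicator_iff)
  qed (use f in auto)
  then show ?thesis by simp
qed

lemma integrable_norm_powr_cball:
  fixes b R :: real
  assumes "b + real DIM('a) > 0" "R > 0"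
  shows "integrable lborel (\<lambda>w::'a::euclidean_space. indicator (cball 0 R) w * norm w powr b)"
proof -
  have "integrable lborel (\<lambda>w::'a. indicator {..R} (norm w) * norm w powr b)"
  proof (rule integrable_radial[where f="\<lambda>r. indicator {..R} r * r powr b"])
    have "(\<lambda>r. indicator {0<..} r * (indicator {..R} r * r powr b * r powr (real DIM('a) - 1))) =
      (\<lambda>t. indicator {0<..R} t * t powr (b + real DIM('a) - 1))"
      by (auto simp: fun_eq_iff indicator_def powr_add[symmetric] add_diff_eq)
    then show "integrable lborel (\<lambda>r. indicator {0<..} r * (indicator {..R} r * r powr b * r powr (real DIM('a) - 1)))"
      using integrable_powr_Ioc[of "b + real DIM('a)" R] assms by simp
  qed auto
  then show ?thesis by (simp add: indicator_def)
qed

lemma integrable_norm_powr_compl: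
  fixes c R :: real
  assumes "c > real DIM('a)" "R > 0"
  shows "integrable lborel (\<lambda>w::'a::euclidean_space. indicator {w. R < norm w} w * norm w powr (- c))"
proof -
  have "integrable lborel (\<lambda>w::'a. indicator {R<..} (norm w) * norm w powr (-c))"
  proof (rule integrable_radial[where f="\<lambda>r. indicator {R<..} r * r powr (-c)"])
    have "(\<lambda>r. indicator {0<..} r * (indicator {R<..} r * r powr (-c) * r powr (real DIM('a) - 1))) =
      (\<lambda>t. indicator {R<..} t * t powr (- (c - real DIM('a)) - 1))"
      using assms by (auto simp: fun_eq_iff indicator_def powr_add[symmetric] add_diff_eq)
    then show "integrable lborel (\<lambda>r. indicator {0<..} r * (indicator {R<..} r * r powr (-c) * r powr (real DIM('a) - 1)))"
      using integrable_powr_Ioi[of "c - real DIM('a)" R] assms by simp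
  qed auto
  then show ?thesis by (simp add: indicator_def)
qed

text \<open>The constant \<open>c\<close>, in effect the integral of \<open>g\<close> over the unit
  sphere, is fixed before the weight \<open>f\<close>, so that quite different weights can be
  compared through one number. The positive and negative parts of \<open>g\<close> inherit its
  homogeneity and are treated separately; \<open>c\<close> may have either sign or vanish.\<close>

lemma integral_homogeneous_radial_signed:
  fixes g :: "'a::euclidean_space \<Rightarrow> real"
  defines "e b \<equiv> b + real DIM('a)"
  assumes [measurable]: "g \<in> borel_measurable borel"
    and hom: "\<And>r w. r > 0 \<Longrightarrow> g (r *\<^sub>R w) = r powr b * g w"
    and bound: "\<And>w. \<bar>g w\<bar> \<le> M * norm w powr b"
    and pos: "0 < e b"
  obtains c where "\<And>f. f \<in> borel_measurable borel \<Longrightarrow>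
      integrable lborel (\<lambda>r. indicator {0<..} r * (f r * r powr (e b - 1))) \<Longrightarrow>
      integrable lborel (\<lambda>w. g w * f (norm w)) \<and>
      (LINT w|lborel. g w * f (norm w)) = c * (LINT r|lborel. indicator {0<..} r * (f r * r powr (e b - 1)))"
proof -
  have int: "integrable lborel (\<lambda>w::'a. indicator (cball 0 1) w * q w)"
    if [measurable]: "q \<in> borel_measurable borel" and q: "\<And>w. 0 \<le> q w" "\<And>w. q w \<le> \<bar>g w\<bar>" for q
  proof (rule Bochner_Integration.integrable_bound)
    show "integrable lborel (\<lambda>w::'a. M * (indicator (cball 0 1) w * norm w powr b))"
      using integrable_norm_powr_cball[of b 1, where 'a='a] pos unfolding e_def by auto
    show "AE x in lborel. norm (indicator (cball 0 1) x * q x) \<le> norm (M * (indicator (cball 0 1) x * norm x powr b))"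
    proof (intro AE_I2)
      fix w :: 'a
      have "q w \<le> \<bar>M * norm w powr b\<bar>"
        using q(2)[of w] bound[of w] by linarith
      then show "norm (indicator (cball 0 1) w * q w) \<le> norm (M * (indicator (cball 0 1) w * norm w powr b))"
        using q(1)[of w] by (auto simp: indicator_def)
    qed
  qed auto
  define c where "c q = e b * (LINT w|lborel. indicator (cball 0 1) w * q w)" for q :: "'a \<Rightarrow> real"
  define gp where "gp w = max 0 (g w)" for w
  define gm where "gm w = max 0 (- g w)" for w
  have [measurable]: "gp \<in> borel_measurable borel" "gm \<in> borel_measurable borel"
    unfolding gp_def gm_def by auto
  have nn: "0 \<le> gp w" "0 \<le> gm w" "gp w \<le> \<bar>g w\<bar>" "gm w \<le> \<bar>g w\<bar>" "g w = gp w - gm w" for w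
    by (auto simp: gp_def gm_def)
  have hp: "gp (r *\<^sub>R w) = r powr b * gp w" "gm (r *\<^sub>R w) = r powr b * gm w" if "r > 0" for r w
    using that by (auto simp: gp_def gm_def hom max_def zero_le_mult_iff mult_le_0_iff)
  show ?thesis
  proof (rule that[of "c gp - c gm"])
    fix f :: "real \<Rightarrow> real"
    assume f: "f \<in> borel_measurable borel"
      "integrable lborel (\<lambda>r. indicator {0<..} r * (f r * r powr (e b - 1)))"
    note R = integrable_homogeneous_radial[OF _ f(1) _ _ _ _ f(2)[unfolded e_def], folded e_def]
    have p: "integrable lborel (\<lambda>w. gp w * f (norm w))"
      "(LINT w|lborel. gp w * f (norm w)) = c gp * (LINT r|lborel. indicator {0<..} r * (f r * r powr (e b - 1)))"
      unfolding c_def by (rule R; use nn hp pos int in auto)+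
    have m: "integrable lborel (\<lambda>w. gm w * f (norm w))"
      "(LINT w|lborel. gm w * f (norm w)) = c gm * (LINT r|lborel. indicator {0<..} r * (f r * r powr (e b - 1)))"
      unfolding c_def by (rule R; use nn hp pos int in auto)+
    have gf: "(\<lambda>w. g w * f (norm w)) = (\<lambda>w. gp w * f (norm w) - gm w * f (norm w))"
      by (subst nn(5)) (simp add: left_diff_distrib)
    show "integrable lborel (\<lambda>w. g w * f (norm w)) \<and>
      (LINT w|lborel. g w * f (norm w)) = (c gp - c gm) * (LINT r|lborel. indicator {0<..} r * (f r * r powr (e b - 1)))"
      unfolding gf using p m by (simp add: left_diff_distrib)
  qed
qed

text \<open>Averaging the integral over the translates by \<open>t *\<^sub>R a\<close> with \<open>0 \<le> t \<le> 1\<close> replaces the singular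
  integrand by its mean along lines, which is bounded.\<close>

lemma nn_integral_abs_inner_powr_cball:
  fixes a :: "'a::euclidean_space" and k :: real
  assumes a: "a \<noteq> 0" and k: "-1 < k" "k < 0"
  shows "(\<integral>\<^sup>+w. ennreal (indicator (cball 0 1) w * \<bar>a \<bullet> w\<bar> powr k) \<partial>lborel) < \<infinity>"
proof -
  \<comment> \<open>Translating by \<open>- t *\<^sub>R a\<close> changes a . w by -t A, so
    averaging over t crosses the singular hyperplane transversally. The radius \<open>R\<close>
    below is large enough for all the translates of the unit ball.\<close>
  define A where "A = a \<bullet> a"
  have A: "A > 0" using a by (simp add: A_def)
  define R where "R = 1 + norm a"
  define J where "J = (\<integral>\<^sup>+(x::real). ennreal (indicator (cball 0 1) x * norm x powr k) \<partial>lborel)"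
  have J: "J < \<infinity>"
    using integrable_norm_powr_cball[of k 1, where 'a=real] k unfolding J_def
    by (auto simp: integrable_iff_bounded)
  define I where "I = (\<integral>\<^sup>+w. ennreal (indicator (cball 0 1) w * \<bar>a \<bullet> w\<bar> powr k) \<partial>lborel)"
  have shift: "I \<le> (\<integral>\<^sup>+w. indicator (cball 0 R) w * ennreal (\<bar>a \<bullet> w - t * A\<bar> powr k) \<partial>lborel)"
    if "t \<in> {0..1}" for t
  proof -
    have "I = (\<integral>\<^sup>+w. ennreal (indicator (cball 0 1) (- t *\<^sub>R a + 1 *\<^sub>R w) * \<bar>a \<bullet> (- t *\<^sub>R a + 1 *\<^sub>R w)\<bar> powr k) \<partial>lborel)"
      unfolding I_def by (subst nn_integral_affine_euclidean[where t="- t *\<^sub>R a" and c=1]) simp_all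
    also have "\<dots> \<le> (\<integral>\<^sup>+w. indicator (cball 0 R) w * ennreal (\<bar>a \<bullet> w - t * A\<bar> powr k) \<partial>lborel)"
    proof (intro nn_integral_mono)
      fix w :: 'a
      have "norm w \<le> R" if "norm (- t *\<^sub>R a + w) \<le> 1"
      proof -
        have "norm w = norm ((- t *\<^sub>R a + w) + t *\<^sub>R a)" by simp
        also have "\<dots> \<le> 1 + \<bar>t\<bar> * norm a" using that by (intro norm_triangle_le) simp
        also have "\<dots> \<le> R" using \<open>t \<in> {0..1}\<close> by (auto simp: R_def mult_left_le_one_le)
        finally show ?thesis .
      qed
      then show "ennreal (indicator (cball 0 1) (- t *\<^sub>R a + 1 *\<^sub>R w) * \<bar>a \<bullet> (- t *\<^sub>R a + 1 *\<^sub>R w)\<bar> powr k)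
        \<le> indicator (cball 0 R) w * ennreal (\<bar>a \<bullet> w - t * A\<bar> powr k)"
        by (auto simp: indicator_def inner_add_right inner_diff_right A_def)
    qed
    finally show ?thesis .
  qed
  \<comment> \<open>Since k < 0, points where the base exceeds 1 contribute at most 1 to the mean.
    The others contribute at most J / A after a substitution of slope -A, uniformly in x.\<close>
  have line: "(\<integral>\<^sup>+t. indicator {0..1} t * ennreal (\<bar>x - t * A\<bar> powr k) \<partial>lborel) \<le> 1 + J / A" for x
  proof -
    have "(\<integral>\<^sup>+t. indicator {0..1} t * ennreal (\<bar>x - t * A\<bar> powr k) \<partial>lborel) \<le>
      (\<integral>\<^sup>+t. indicator {0..1} t + ennreal (indicator (cball 0 1) (x + (- A) * t) * norm (x + (- A) * t) powr k) \<partial>lborel)"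
    proof (intro nn_integral_mono)
      fix t :: real
      have "\<bar>x - t * A\<bar> powr k \<le> 1" if "\<not> \<bar>x - t * A\<bar> \<le> 1"
        using that k powr_mono[of k 0 "\<bar>x - t * A\<bar>"] by (simp split: if_splits)
      then show "indicator {0..1} t * ennreal (\<bar>x - t * A\<bar> powr k) \<le>
         indicator {0..1} t + ennreal (indicator (cball 0 1) (x + (- A) * t) * norm (x + (- A) * t) powr k)"
        by (auto simp: indicator_def mult.commute)
    qed
    also have "\<dots> = 1 + (\<integral>\<^sup>+t. ennreal (indicator (cball 0 1) (x + (- A) * t) * norm (x + (- A) * t) powr k) \<partial>lborel)"
      by (subst nn_integral_add) auto
    also have "(\<integral>\<^sup>+t. ennreal (indicator (cball 0 1) (x + (- A) * t) * norm (x + (- A) * t) powr k) \<partial>lborel) = J / A"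
    proof -
      have "J = ennreal A * (\<integral>\<^sup>+t. ennreal (indicator (cball 0 1) (x + (- A) * t) * norm (x + (- A) * t) powr k) \<partial>lborel)"
        unfolding J_def using A by (subst nn_integral_real_affine[where c="-A" and t=x]) auto
      then show ?thesis using A 
        by (simp add: ennreal_mult_divide_eq mult.commute[of "ennreal A"])
    qed
    finally show ?thesis .
  qed
  \<comment> \<open>\<open>I\<close> is its own mean over the unit interval; Fubini then allows the
    mean over t to be taken before the integral in w.\<close>
  have "I = (\<integral>\<^sup>+t. indicator {0..1} t * I \<partial>(lborel :: real measure))"
    by (subst nn_integral_multc) auto
  also have "\<dots> \<le> (\<integral>\<^sup>+t. (\<integral>\<^sup>+w. indicator {0..1} t * (indicator (cball 0 R) w * ennreal (\<bar>a \<bullet> w - t * A\<bar> powr k)) \<partial>lborel) \<partial>lborel)"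
    using shift by (intro nn_integral_mono) (auto simp: indicator_def)
  also have "\<dots> = (\<integral>\<^sup>+w. (\<integral>\<^sup>+t. indicator {0..1} t * (indicator (cball 0 R) w * ennreal (\<bar>a \<bullet> w - t * A\<bar> powr k)) \<partial>lborel) \<partial>lborel)"
    by (rule lborel_pair.Fubini') measurable
  also have "\<dots> = (\<integral>\<^sup>+w. indicator (cball 0 R) w * (\<integral>\<^sup>+t. indicator {0..1} t * ennreal (\<bar>a \<bullet> w - t * A\<bar> powr k) \<partial>lborel) \<partial>lborel)"
    by (subst nn_integral_cmult[symmetric]) (auto simp: mult_ac)
  also have "\<dots> \<le> (\<integral>\<^sup>+(w::'a). indicator (cball 0 R) w * (1 + J / A) \<partial>lborel)"
    using line by (intro nn_integral_mono mult_left_mono) auto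
  also have "\<dots> = emeasure lborel (cball (0::'a) R) * (1 + J / A)"
    by (subst nn_integral_multc) auto
  also have "\<dots> < \<infinity>"
    using J A emeasure_lborel_cball_finite[of "0::'a" R] by (auto simp: ennreal_mult_less_top divide_ennreal_def inverse_ennreal)
  finally show ?thesis unfolding I_def .
qed

text \<open>The factor |a . w|^k is itself homogeneous of degree k and integrable on the unit ball,
  so the extra power of the norm is merely a radial weight. Later a is the gradient up to sign and k
  = p - 2.\<close>

lemma integrable_norm_powr_inner_powr_cball:
  fixes a :: "'a::euclidean_space" and b k :: real
  assumes a: "a \<noteq> 0" and k: "-1 < k" "k < 0" and b: "b + k + real DIM('a) > 0"
  shows "integrable lborel (\<lambda>w. indicator (cball 0 1) w * norm w powr b * \<bar>a \<bullet> w\<bar> powr k)"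
proof -
  have D: "real DIM('a) \<ge> 1" using DIM_positive[where 'a='a] by linarith
  have "integrable lborel (\<lambda>w. \<bar>a \<bullet> w\<bar> powr k * (indicator {..1} (norm w) * norm w powr b))"
  proof (rule integrable_homogeneous_radial(1)[where b=k and f="\<lambda>r. indicator {..1} r * r powr b"])
    show "integrable lborel (\<lambda>w. indicator (cball 0 1) w * \<bar>a \<bullet> w\<bar> powr k)"
      using nn_integral_abs_inner_powr_cball[OF a k] by (intro integrableI_nonneg) auto
    have "(\<lambda>r. indicator {0<..} r * (indicator {..1} r * r powr b * r powr (k + real DIM('a) - 1))) =
      (\<lambda>t. indicator {0<..1} t * t powr (b + k + real DIM('a) - 1))"
      by (auto simp: fun_eq_iff indicator_def powr_add[symmetric] algebra_simps)
    then show "integrable lborel (\<lambda>r. indicator {0<..} r * (indicator {..1} r * r powr b * r powr (k + real DIM('a) - 1)))"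
      using integrable_powr_Ioc[of "b + k + real DIM('a)" 1] b by simp
    show "\<bar>a \<bullet> r *\<^sub>R w\<bar> powr k = r powr k * \<bar>a \<bullet> w\<bar> powr k" if "r > 0" for r w
      using that by (simp add: abs_mult powr_mult)
    show "0 < k + real DIM('a)" using k D by linarith
  qed auto
  then show ?thesis by (simp add: indicator_def mult_ac)
qed

text \<open>The substitution t -> 1/t turns the one-sided limit into dominated convergence along a
  continuous parameter at infinity.\<close>

lemma integral_dominated_convergence_at_right_0:
  fixes s :: "real \<Rightarrow> 'a \<Rightarrow> real"
  assumes "f \<in> borel_measurable M" "\<And>t. s t \<in> borel_measurable M" "integrable M w"
    and lim: "AE x in M. ((\<lambda>t. s t x) \<longlongrightarrow> f x) (at_right 0)"
    and bound: "\<And>t. t > 0 \<Longrightarrow> AE x in M. \<bar>s t x\<bar> \<le> w x"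
  shows "((\<lambda>t. LINT x|M. s t x) \<longlongrightarrow> (LINT x|M. f x)) (at_right 0)"
proof -
  have "((\<lambda>t. LINT x|M. s (inverse t) x) \<longlongrightarrow> (LINT x|M. f x)) at_top"
  proof (rule integral_dominated_convergence_at_top)
    show "AE x in M. ((\<lambda>t. s (inverse t) x) \<longlongrightarrow> f x) at_top"
      using lim by (simp add: filterlim_at_right_to_top)
    show "\<forall>\<^sub>F t in at_top. AE x in M. norm (s (inverse t) x) \<le> w x"
      using eventually_gt_at_top[of 0] by eventually_elim (use bound in auto)
  qed (use assms in auto)
  then show ?thesis by (simp add: filterlim_at_right_to_top)
qed

section \<open>Estimates for \<open>Phi\<close>\<close>

lemma Phi_nonneg: "t \<ge> 0 \<Longrightarrow> Phi p t = t powr (p - 1)"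
  using powr_add[of t "p - 2" 1] by (cases "t = 0") (auto simp: Phi_def)

lemma Phi_minus [simp]: "Phi p (- t) = - Phi p t"
  by (simp add: Phi_def)

lemma abs_Phi: "\<bar>Phi p t\<bar> = \<bar>t\<bar> powr (p - 1)"
proof -
  have "\<bar>Phi p t\<bar> = \<bar>Phi p \<bar>t\<bar>\<bar>" by (cases "t \<ge> 0") auto
  then show ?thesis by (simp add: Phi_nonneg)
qed

lemma Phi_mult: "r > 0 \<Longrightarrow> Phi p (r * t) = r powr (p - 1) * Phi p t"
  using powr_add[of r "p - 2" 1] by (simp add: Phi_def abs_mult powr_mult)

lemma continuous_on_Phi:
  assumes "p > 1"
  shows "continuous_on UNIV (Phi p)"
proof -
  \<comment> \<open>For p < 2 the defining factor |t|^(p-2) blows up at 0; splitting by sign leaves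
    only the positive exponent p - 1.\<close>
  have eq: "Phi p = (\<lambda>t. max 0 t powr (p - 1) - max 0 (- t) powr (p - 1))"
  proof
    fix t show "Phi p t = max 0 t powr (p - 1) - max 0 (- t) powr (p - 1)"
      using Phi_nonneg[of t p] Phi_nonneg[of "-t" p] by (cases "t \<ge> 0") (auto simp: max_def)
  qed
  show ?thesis unfolding eq using assms
    by (intro continuous_on_diff continuous_on_powr' continuous_intros) auto
qed

section \<open>Difference estimates for powers, transferred to the odd power function\<close>

lemma powr_subadditive:
  fixes a b q :: real
  assumes "0 < q" "q \<le> 1" "0 \<le> a" "0 \<le> b"
  shows "(a + b) powr q \<le> a powr q + b powr q"
proof (cases "a = 0 \<or> b = 0")
  case False
  then have ab: "a > 0" "b > 0" using assms by auto
  \<comment> \<open>The exponent q - 1 is not positive, so replacing the base a + b by a or by b can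
    only increase each summand.\<close>
  have "(a + b) powr q = (a + b) powr (q - 1) * (a + b)"
    using powr_add[of "a + b" "q - 1" 1] ab by simp
  also have "\<dots> = (a + b) powr (q - 1) * a + (a + b) powr (q - 1) * b"
    by (simp add: distrib_left)
  also have "\<dots> \<le> a powr (q - 1) * a + b powr (q - 1) * b"
    using ab assms by (intro add_mono mult_right_mono powr_mono2') auto
  also have "\<dots> = a powr q + b powr q"
    using powr_add[of a "q - 1" 1] powr_add[of b "q - 1" 1] ab by simp
  finally show ?thesis .
qed auto

lemma powr_diff_hoelder:
  fixes x y q :: real
  assumes "0 < q" "q \<le> 1" "0 \<le> x" "0 \<le> y"
  shows "\<bar>x powr q - y powr q\<bar> \<le> \<bar>x - y\<bar> powr q"
proof -
  have *: "\<bar>x powr q - y powr q\<bar> \<le> \<bar>x - y\<bar> powr q" if le: "x \<le> y" "0 \<le> x" "0 \<le> y" for x y :: real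
  proof -
    have "x powr q \<le> y powr q" using le assms by (intro powr_mono2) auto
    then show ?thesis
      using powr_subadditive[of q x "y - x"] le assms by simp
  qed
  show ?thesis
    using assms *[of x y] *[of y x] linear[of x y]
    by (auto simp: abs_minus_commute)
qed

lemma powr_diff_mvt:
  fixes x y q :: real
  assumes "0 < x" "x < y"
  obtains z where "x < z" "z < y" "y powr q - x powr q = (y - x) * (q * z powr (q - 1))"
proof -
  have "\<exists>z. x < z \<and> z < y \<and> y powr q - x powr q = (y - x) * (q * z powr (q - 1))"
  proof (rule MVT2)
    show "((\<lambda>z. z powr q) has_real_derivative q * z powr (q - 1)) (at z)" if "x \<le> z" for z
      using that assms by (intro has_real_derivative_powr) auto
  qed (use assms in auto)
  then show ?thesis using that by blast
qed

lemma powr_diff_le_max: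
  fixes x y q :: real
  assumes "1 \<le> q" "0 \<le> x" "0 \<le> y"
  shows "\<bar>x powr q - y powr q\<bar> \<le> q * \<bar>x - y\<bar> * max x y powr (q - 1)"
proof -
  have *: "\<bar>x powr q - y powr q\<bar> \<le> q * \<bar>x - y\<bar> * max x y powr (q - 1)" if le: "x \<le> y" "0 \<le> x" "0 \<le> y" for x y :: real
  proof -
    consider "x = y" | "x = 0" "x < y" | "0 < x" "x < y" using le assms by fastforce
    then show ?thesis
    proof cases
      \<comment> \<open>The mean value argument requires a positive left endpoint, so x = 0 is
        computed directly.\<close>
      case 2
      have "y powr q = 1 * (y * y powr (q - 1))"
        using powr_add[of y "q - 1" 1] 2 by simp
      also have "\<dots> \<le> q * (y * y powr (q - 1))"
        using le assms 2 by (intro mult_right_mono) auto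
      finally show ?thesis using 2 le assms by (simp add: mult_ac)
    next
      case 3
      obtain z where z: "x < z" "z < y" "y powr q - x powr q = (y - x) * (q * z powr (q - 1))"
        using powr_diff_mvt[OF 3] by blast
      have "(y - x) * (q * z powr (q - 1)) \<le> (y - x) * (q * y powr (q - 1))"
        using z 3 le assms by (intro mult_left_mono powr_mono2) auto
      moreover have "x powr q \<le> y powr q" using 3 le assms by (intro powr_mono2) auto
      ultimately show ?thesis using z 3 by (simp add: mult_ac max_def)
    qed simp
  qed
  show ?thesis
    using assms *[of x y] *[of y x] linear[of x y]
    by (auto simp: abs_minus_commute max.commute)
qed

text \<open>For \<open>q \<le> 1\<close> the derivative of the power decreases, hence its size at
  the common lower bound \<open>m\<close> controls it throughout. Away from 0 this gives linear
  dependence on the distance.\<close>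

lemma powr_diff_le_lower:
  fixes x y m q :: real
  assumes "0 < q" "q \<le> 1" "0 < m" "m \<le> x" "m \<le> y"
  shows "\<bar>x powr q - y powr q\<bar> \<le> \<bar>x - y\<bar> * m powr (q - 1)"
proof -
  have *: "\<bar>x powr q - y powr q\<bar> \<le> \<bar>x - y\<bar> * m powr (q - 1)" if le: "x \<le> y" "m \<le> x" "m \<le> y" for x y :: real
  proof -
    show ?thesis
    proof (cases "x = y")
      case False
      with le assms have "0 < x" "x < y" by auto
      then obtain z where z: "x < z" "z < y" "y powr q - x powr q = (y - x) * (q * z powr (q - 1))"
        using powr_diff_mvt by blast
      have "q * z powr (q - 1) \<le> 1 * m powr (q - 1)"
        using z le assms by (intro mult_mono powr_mono2') auto
      then have "y powr q - x powr q \<le> (y - x) * m powr (q - 1)"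
        unfolding z(3) using le(1) by (intro mult_left_mono) auto
      moreover have "x powr q \<le> y powr q" using le assms by (intro powr_mono2) auto
      moreover have "\<bar>x - y\<bar> = y - x" using le by simp
      ultimately show ?thesis by simp
    qed simp
  qed
  show ?thesis
    using assms *[of x y] *[of y x] linear[of x y]
    by (auto simp: abs_minus_commute)
qed

text \<open>Oddness of \<open>Phi\<close> leaves two configurations: equal signs, or opposite signs,
  where the difference is a sum of powers and the distance a sum of moduli. \<open>F\<close> stays
  abstract to serve both the Hoelder and the local Lipschitz bound.\<close>

lemma Phi_diff_cases:
  assumes nn: "\<And>x y. 0 \<le> x \<Longrightarrow> 0 \<le> y \<Longrightarrow> \<bar>x powr (p - 1) - y powr (p - 1)\<bar> \<le> F \<bar>x - y\<bar> (max x y)"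
    and opp: "\<And>x y. 0 \<le> x \<Longrightarrow> 0 \<le> y \<Longrightarrow> x powr (p - 1) + y powr (p - 1) \<le> F (x + y) (max x y)"
  shows "\<bar>Phi p x - Phi p y\<bar> \<le> F \<bar>x - y\<bar> (max \<bar>x\<bar> \<bar>y\<bar>)"
proof -
  consider "x \<ge> 0" "y \<ge> 0" | "x \<le> 0" "y \<le> 0" | "x \<ge> 0" "y \<le> 0" | "x \<le> 0" "y \<ge> 0" by linarith
  then show ?thesis
  proof cases
    case 1 then show ?thesis using nn[of x y] by (simp add: Phi_nonneg)
  next
    case 2
    then have "Phi p x = - ((- x) powr (p - 1))" "Phi p y = - ((- y) powr (p - 1))"
      using Phi_nonneg[of "-x" p] Phi_nonneg[of "-y" p] by auto
    then show ?thesis using 2 nn[of "-x" "-y"] by (simp add: abs_minus_commute)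
  next
    case 3
    then have "Phi p x = x powr (p - 1)" "Phi p y = - ((- y) powr (p - 1))"
      using Phi_nonneg[of "x" p] Phi_nonneg[of "-y" p] by auto
    then show ?thesis using 3 opp[of x "-y"] by simp
  next
    case 4
    then have "Phi p x = - ((- x) powr (p - 1))" "Phi p y = y powr (p - 1)"
      using Phi_nonneg[of "-x" p] Phi_nonneg[of "y" p] by auto
    then have "\<bar>Phi p x - Phi p y\<bar> = (- x) powr (p - 1) + y powr (p - 1)"
      by (simp add: abs_minus_commute[of _ "y powr _"])
    also have "\<dots> \<le> F (- x + y) (max (- x) y)" using 4 opp[of "-x" y] by simp
    finally show ?thesis using 4 by simp
  qed
qed

text \<open>For opposite signs each of the two powers is at most that of the distance, whence the
  factor 2.\<close>

lemma Phi_hoelder: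
  assumes "1 < p" "p \<le> 2"
  shows "\<bar>Phi p x - Phi p y\<bar> \<le> 2 * \<bar>x - y\<bar> powr (p - 1)"
proof (rule Phi_diff_cases[where F="\<lambda>d _. 2 * d powr (p - 1)"])
  fix x y :: real assume xy: "0 \<le> x" "0 \<le> y"
  show "\<bar>x powr (p - 1) - y powr (p - 1)\<bar> \<le> 2 * \<bar>x - y\<bar> powr (p - 1)"
    using powr_diff_hoelder[of "p - 1" x y] assms xy powr_ge_zero[of "\<bar>x - y\<bar>" "p - 1"] by linarith
  have "x powr (p - 1) \<le> (x + y) powr (p - 1)" "y powr (p - 1) \<le> (x + y) powr (p - 1)"
    using xy assms by (intro powr_mono2; simp)+
  then show "x powr (p - 1) + y powr (p - 1) \<le> 2 * (x + y) powr (p - 1)" by linarith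
qed

lemma Phi_diff_le_max:
  assumes "2 \<le> p"
  shows "\<bar>Phi p x - Phi p y\<bar> \<le> (p - 1) * \<bar>x - y\<bar> * (max \<bar>x\<bar> \<bar>y\<bar>) powr (p - 2)"
proof (rule Phi_diff_cases[where F="\<lambda>d m. (p - 1) * d * m powr (p - 2)"])
  fix x y :: real assume xy: "0 \<le> x" "0 \<le> y"
  show "\<bar>x powr (p - 1) - y powr (p - 1)\<bar> \<le> (p - 1) * \<bar>x - y\<bar> * max x y powr (p - 2)"
    using powr_diff_le_max[of "p - 1" x y] assms xy by simp
  have *: "z powr (p - 1) \<le> z * max x y powr (p - 2)" if "0 \<le> z" "z \<le> max x y" for z
  proof (cases "z = 0")
    case False
    then have "z powr (p - 1) = z * z powr (p - 2)"
      using powr_add[of z "p - 2" 1] that by simp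
    also have "\<dots> \<le> z * max x y powr (p - 2)"
      using that assms by (intro mult_left_mono powr_mono2) auto
    finally show ?thesis .
  qed simp
  have "x powr (p - 1) + y powr (p - 1) \<le> 1 * ((x + y) * max x y powr (p - 2))"
    using *[of x] *[of y] xy by (simp add: distrib_right)
  also have "\<dots> \<le> (p - 1) * ((x + y) * max x y powr (p - 2))"
    using assms xy by (intro mult_right_mono) auto
  finally show "x powr (p - 1) + y powr (p - 1) \<le> (p - 1) * (x + y) * max x y powr (p - 2)"
    by (simp add: mult_ac)
qed

text \<open>At \<open>t = 0\<close> the right-hand side would be \<open>0\<close> for \<open>p < 2\<close>, because \<open>0 powr a = 0\<close>.\<close>

lemma Phi_diff_le_singular:
  assumes p: "1 < p" "p \<le> 2" and t: "t \<noteq> 0"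
  shows "\<bar>Phi p (t + b) - Phi p t\<bar> \<le> 4 * \<bar>b\<bar> * \<bar>t\<bar> powr (p - 2)"
proof -
  \<comment> \<open>Halving the base costs the factor 2^(2-p), at most 2 because p > 1.\<close>
  have half: "(c / 2) powr (p - 2) \<le> 2 * c powr (p - 2)" if "c > 0" for c :: real
  proof -
    have "(1 / 2 :: real) powr (p - 2) = 2 powr (2 - p)"
      using powr_minus_divide[of 2 "p - 2"] by (simp add: powr_divide)
    also have "\<dots> \<le> 2 powr 1" using p by (intro powr_mono) auto
    finally have "(1 / 2 :: real) powr (p - 2) \<le> 2" by simp
    then have "c powr (p - 2) * (1 / 2) powr (p - 2) \<le> c powr (p - 2) * 2"
      by (intro mult_left_mono) auto
    then show ?thesis using that by (simp add: powr_divide mult_ac)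
  qed
  have *: "\<bar>Phi p (t + b) - Phi p t\<bar> \<le> 4 * \<bar>b\<bar> * t powr (p - 2)" if t: "t > 0" for t b
  \<comment> \<open>A small \<open>b\<close> keeps both arguments above t / 2, where the power is
    Lipschitz. For a large one the Hoelder bound suffices: |b|^(p-1) = |b| |b|^(p-2), and the last
    factor is at most (t/2)^(p-2).\<close>
  proof (cases "\<bar>b\<bar> \<le> t / 2")
    case True
    then have "t / 2 \<le> t + b" by (auto simp: abs_if split: if_splits)
    have "\<bar>Phi p (t + b) - Phi p t\<bar> = \<bar>(t + b) powr (p - 1) - t powr (p - 1)\<bar>"
      using t \<open>t / 2 \<le> t + b\<close> by (simp add: Phi_nonneg)
    also have "\<dots> \<le> \<bar>t + b - t\<bar> * (t / 2) powr (p - 1 - 1)"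
      using t \<open>t / 2 \<le> t + b\<close> p by (intro powr_diff_le_lower) auto
    also have "\<dots> \<le> \<bar>b\<bar> * (2 * t powr (p - 2))"
      using half[OF t] by (simp add: mult_left_mono)
    also have "\<dots> \<le> 4 * \<bar>b\<bar> * t powr (p - 2)" by (simp add: mult_right_mono)
    finally show ?thesis .
  next
    case False
    have "\<bar>Phi p (t + b) - Phi p t\<bar> \<le> 2 * \<bar>b\<bar> powr (p - 1)"
      using Phi_hoelder[OF p, of "t + b" t] by simp
    also have "\<dots> = 2 * (\<bar>b\<bar> * \<bar>b\<bar> powr (p - 2))"
      using powr_add[of "\<bar>b\<bar>" "p - 2" 1] False t by simp
    also have "\<dots> \<le> 2 * (\<bar>b\<bar> * (t / 2) powr (p - 2))"
      using False t p by (intro mult_left_mono powr_mono2') auto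
    also have "\<dots> \<le> 2 * (\<bar>b\<bar> * (2 * t powr (p - 2)))"
      using half[OF t] by (intro mult_left_mono) auto
    finally show ?thesis by simp
  qed
  show ?thesis
  proof (cases "t > 0")
    case False
    have "\<bar>Phi p (t + b) - Phi p t\<bar> = \<bar>Phi p (- t + - b) - Phi p (- t)\<bar>"
      using Phi_minus[of p "t + b"] by (simp add: abs_minus_commute)
    then show ?thesis using *[of "-t" "-b"] False t by simp
  qed (use *[of t b] in simp)
qed

section \<open>Second-order expansion of \<open>C2b\<close> functions\<close>

text \<open>A candidate is assembled from the values of the derivative on the basis; uniqueness of
  derivatives then shows that the definite description in \<open>gradient\<close> denotes
  it.\<close>

lemma C2b_GDERIV:
  assumes "C2b u" shows "GDERIV u x :> gradient u x"
proof -
  obtain u' :: "'a \<Rightarrow> 'a \<Rightarrow>\<^sub>L real" where u: "(u has_derivative blinfun_apply (u' x)) (at x)"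
    using assms unfolding C2b_def by blast
  define D where "D = (\<Sum>b\<in>Basis. blinfun_apply (u' x) b *\<^sub>R b)"
  have "blinfun_apply (u' x) h = h \<bullet> D" for h
  proof -
    have "blinfun_apply (u' x) h = blinfun_apply (u' x) (\<Sum>b\<in>Basis. (h \<bullet> b) *\<^sub>R b)"
      by (simp add: euclidean_representation)
    also have "\<dots> = h \<bullet> D"
      by (simp add: blinfun.sum_right blinfun.scaleR_right D_def inner_sum_right mult.commute)
    finally show ?thesis .
  qed
  then have D: "GDERIV u x :> D"
    using u unfolding gderiv_def by presburger
  moreover have "D' = D" if "GDERIV u x :> D'" for D'
  proof -
    have "(\<lambda>h. h \<bullet> D') = (\<lambda>h. h \<bullet> D)"
      using that D unfolding gderiv_def by (rule has_derivative_unique)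
    then have "h \<bullet> D' = h \<bullet> D" for h by metis
    then show ?thesis using vector_eq_ldot by blast
  qed
  ultimately show ?thesis unfolding gradient_def by (metis theI)
qed

text \<open>The global bound provides majorants; the pointwise limit provides the blow-up at the
  borderline exponent. \<open>H\<close> is half the quadratic form of the Hessian at
  \<open>x\<close>.\<close>

lemma C2b_taylor:
  fixes u :: "'a::euclidean_space \<Rightarrow> real"
  assumes "C2b u"
  obtains M H where "M \<ge> 0"
    "\<And>z. \<bar>u (x + z) - u x - gradient u x \<bullet> z\<bar> \<le> M * (norm z)\<^sup>2"
    "continuous_on UNIV H" "\<And>r w. H (r *\<^sub>R w) = r\<^sup>2 * H w"
    "\<And>w. ((\<lambda>y. (u (x + y *\<^sub>R w) - u x - y * (gradient u x \<bullet> w)) / y\<^sup>2) \<longlongrightarrow> H w) (at_right 0)"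
proof -
  obtain u' :: "'a \<Rightarrow> 'a \<Rightarrow>\<^sub>L real" and u'' :: "'a \<Rightarrow> 'a \<Rightarrow>\<^sub>L 'a \<Rightarrow>\<^sub>L real"
    where u': "\<And>x. (u has_derivative blinfun_apply (u' x)) (at x)"
      and u'': "\<And>x. (u' has_derivative blinfun_apply (u'' x)) (at x)"
      and b: "bounded (range u'')"
    using assms unfolding C2b_def by blast
  obtain M where M: "\<And>x. norm (u'' x) \<le> M"
    using b unfolding bounded_iff by auto
  have M0: "M \<ge> 0" using M[of 0] norm_ge_zero[of "u'' 0"] by linarith
  have grad: "blinfun_apply (u' x) h = gradient u x \<bullet> h" for h
  proof -
    have "blinfun_apply (u' x) = (\<lambda>h. h \<bullet> gradient u x)"
      using u' C2b_GDERIV[OF assms] unfolding gderiv_def by (metis has_derivative_unique)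
    then show ?thesis by (simp add: inner_commute)
  qed
  have lip: "norm (u' (x + v) - u' x) \<le> M * norm v" for v
    using differentiable_bound[of UNIV u' "\<lambda>x. blinfun_apply (u'' x)" M "x + v" x] u'' M
    by (auto simp: norm_blinfun.rep_eq[symmetric])
  \<comment> \<open>The bounded Hessian makes the derivative Lipschitz, so on the ball of radius
    \<open>norm z\<close> it deviates from its value at x by at most M times that radius.\<close>
  have T: "\<bar>u (x + z) - u x - gradient u x \<bullet> z\<bar> \<le> M * (norm z)\<^sup>2" for z
  proof -
    have "norm (u (x + z) - u x - blinfun_apply (u' x) (x + z - x)) \<le> norm (x + z - x) * (M * norm z)"
    proof (rule differentiable_bound_linearization[where S="cball x (norm z)" and f'="\<lambda>x. blinfun_apply (u' x)"])
      show "x + t *\<^sub>R (x + z - x) \<in> cball x (norm z)" if "t \<in> {0..1}" for t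
        using that by (auto simp: dist_norm mult_left_le_one_le)
      show "(u has_derivative blinfun_apply (u' y)) (at y within cball x (norm z))" for y
        using u' has_derivative_at_withinI by blast
      show "onorm (blinfun_apply (u' v) - blinfun_apply (u' x)) \<le> M * norm z"
        if "v \<in> cball x (norm z)" for v
      proof -
        have "onorm (blinfun_apply (u' v) - blinfun_apply (u' x)) = norm (u' v - u' x)"
          by (simp add: norm_blinfun.rep_eq minus_blinfun.rep_eq fun_diff_def)
        also have "\<dots> \<le> M * norm (v - x)" using lip[of "v - x"] by simp
        also have "\<dots> \<le> M * norm z"
          using that M0 by (intro mult_left_mono) (auto simp: dist_norm norm_minus_commute)
        finally show ?thesis .
      qed
    qed simp
    then show ?thesis by (simp add: grad power2_eq_square mult_ac)
  qed
  define H where "H w = blinfun_apply (blinfun_apply (u'' x) w) w / 2" for w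
  have lim: "((\<lambda>y. (u (x + y *\<^sub>R w) - u x - y * (gradient u x \<bullet> w)) / y\<^sup>2) \<longlongrightarrow> H w) (at_right 0)" for w
  proof -
    define f where "f y = u (x + y *\<^sub>R w) - u x - y * (gradient u x \<bullet> w)" for y
    define f' where "f' y = blinfun_apply (u' (x + y *\<^sub>R w)) w - gradient u x \<bullet> w" for y
    have df: "(f has_real_derivative f' y) (at y)" for y
    proof -
      have "((\<lambda>y. u (x + y *\<^sub>R w)) has_derivative (\<lambda>h. blinfun_apply (u' (x + y *\<^sub>R w)) (h *\<^sub>R w))) (at y)"
        by (rule has_derivative_compose[of "\<lambda>y. x + y *\<^sub>R w", OF _ u']) (auto intro!: derivative_eq_intros)
      then have "((\<lambda>y. u (x + y *\<^sub>R w)) has_real_derivative blinfun_apply (u' (x + y *\<^sub>R w)) w) (at y)"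
        by (simp add: has_field_derivative_def blinfun.scaleR_right mult_commute_abs)
      then show ?thesis unfolding f_def f'_def by (auto intro!: derivative_eq_intros)
    qed
    have df': "(f' has_real_derivative 2 * H w) (at 0)"
    proof -
      have "((\<lambda>y. u' (x + y *\<^sub>R w)) has_derivative (\<lambda>h. blinfun_apply (u'' x) (h *\<^sub>R w))) (at 0)"
      proof -
        have 1: "((\<lambda>y. x + y *\<^sub>R w) has_derivative (\<lambda>h. h *\<^sub>R w)) (at 0)"
          by (auto intro!: derivative_eq_intros)
        have 2: "(u' has_derivative blinfun_apply (u'' x)) (at (x + 0 *\<^sub>R w))"
          using u''[of x] by simp
        show ?thesis using has_derivative_compose[OF 1 2] .
      qed
      then have "((\<lambda>y. blinfun_apply (u' (x + y *\<^sub>R w)) w) has_derivative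
          (\<lambda>h. blinfun_apply (blinfun_apply (u'' x) (h *\<^sub>R w)) w)) (at 0)"
        by (auto intro!: derivative_eq_intros)
      then have "((\<lambda>y. blinfun_apply (u' (x + y *\<^sub>R w)) w) has_real_derivative 2 * H w) (at 0)"
        by (simp add: has_field_derivative_def blinfun.scaleR_right blinfun.scaleR_left mult_commute_abs H_def)
      then show ?thesis unfolding f'_def by (auto intro!: derivative_eq_intros)
    qed
    \<comment> \<open>Since f' vanishes at 0, this is its difference quotient there; one application
      of l'Hopital's rule to f / y^2 then suffices.\<close>
    have "((\<lambda>y. f' y / y) \<longlongrightarrow> 2 * H w) (at_right 0)"
      using df' unfolding has_field_derivative_iff
      by (auto simp: f'_def grad intro: tendsto_within_subset)
    then have "((\<lambda>y. f' y / y / 2) \<longlongrightarrow> 2 * H w / 2) (at_right 0)"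
      by (intro tendsto_intros) auto
    then have l: "((\<lambda>y. f' y / (2 * y)) \<longlongrightarrow> H w) (at_right 0)"
      by (simp add: mult.commute)
    have "((\<lambda>y. f y / y\<^sup>2) \<longlongrightarrow> H w) (at_right 0)"
    proof (rule lhopital_right_0[OF _ _ _ _ _ _ l])
      have "isCont f 0" using df DERIV_isCont by blast
      then show "(f \<longlongrightarrow> 0) (at_right 0)"
        unfolding isCont_def by (auto simp: f_def intro: tendsto_within_subset)
      show "((\<lambda>y. y\<^sup>2) \<longlongrightarrow> 0) (at_right (0::real))"
        by (rule tendsto_eq_intros refl | simp)+
      show "\<forall>\<^sub>F y in at_right 0. y\<^sup>2 \<noteq> (0::real)" "\<forall>\<^sub>F y in at_right 0. 2 * y \<noteq> (0::real)"
        by (auto simp: eventually_at_filter)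
      show "\<forall>\<^sub>F y in at_right 0. (f has_real_derivative f' y) (at y)" using df by simp
      show "\<forall>\<^sub>F y in at_right 0. (power2 has_real_derivative 2 * y) (at y)"
        by (intro always_eventually allI) (auto intro!: derivative_eq_intros)
    qed
    then show ?thesis unfolding f_def .
  qed
  show ?thesis
  proof (rule that[of M H, OF M0 T _ _ lim])
    show "continuous_on UNIV H" unfolding H_def by (intro continuous_intros) auto
    show "H (r *\<^sub>R w) = r\<^sup>2 * H w" for r w
      by (simp add: H_def blinfun.scaleR_right blinfun.scaleR_left power2_eq_square)
  qed
qed

section \<open>Truncated and smoothed singular integrals\<close>

lemma kernel_le_powr:
  fixes a b c :: real
  assumes "0 < a" "0 < c"
  shows "(a\<^sup>2 + b\<^sup>2) powr (- c / 2) \<le> a powr (- c)"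
proof -
  have "(a\<^sup>2 + b\<^sup>2) powr (- c / 2) \<le> (a\<^sup>2) powr (- c / 2)"
    using assms by (intro powr_mono2') auto
  also have "(a\<^sup>2) powr (- c / 2) = a powr (- c)"
    using assms powr_powr[of a 2 "- c / 2"] by simp
  finally show ?thesis .
qed

lemma integrable_truncated_kernel:
  fixes g :: "'a::euclidean_space \<Rightarrow> real"
  assumes [measurable]: "g \<in> borel_measurable borel" and B: "\<And>z. \<bar>g z\<bar> \<le> B"
    and c: "real DIM('a) < c" and r: "0 < r"
  shows "integrable lborel (\<lambda>z. g z * (indicator {r<..} (norm z) * norm z powr (- c)))"
proof (rule Bochner_Integration.integrable_bound)
  show "integrable lborel (\<lambda>z::'a. B * (indicator {z. r < norm z} z * norm z powr (- c)))"
    using integrable_norm_powr_compl[OF c r] by simp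
  have "\<bar>g z\<bar> \<le> \<bar>B\<bar>" for z using B[of z] by linarith
  then show "AE z in lborel. norm (g z * (indicator {r<..} (norm z) * norm z powr (- c)))
      \<le> norm (B * (indicator {z. r < norm z} z * norm z powr (- c)))"
    by (intro AE_I2) (auto simp: indicator_def abs_mult intro!: mult_right_mono)
qed measurable

lemma integrable_smooth_kernel:
  fixes g :: "'a::euclidean_space \<Rightarrow> real"
  assumes [measurable]: "g \<in> borel_measurable borel" and B: "\<And>z. \<bar>g z\<bar> \<le> B"
    and c: "real DIM('a) < c" and y: "0 < y"
  shows "integrable lborel (\<lambda>z. g z * ((norm z)\<^sup>2 + y\<^sup>2) powr (- c / 2))"
proof (rule Bochner_Integration.integrable_bound)
  show "integrable lborel (\<lambda>z::'a. B * (y powr (- c) * indicator (cball 0 1) z + indicator {z. 1 < norm z} z * norm z powr (- c)))"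
    using integrable_norm_powr_compl[OF c, of 1] emeasure_lborel_cball_finite[of "0::'a" 1]
    by (intro integrable_mult_right Bochner_Integration.integrable_add) (auto simp: integrable_indicator_iff)
  have B': "\<bar>g z\<bar> \<le> \<bar>B\<bar>" for z using B[of z] by linarith
  have c0: "c > 0" using c by linarith
  \<comment> \<open>Inside the unit ball the kernel is at most its value at the centre, outside at
    most the tail power.\<close>
  have k: "((norm z)\<^sup>2 + y\<^sup>2) powr (- c / 2) \<le>
      y powr (- c) * indicator (cball 0 1) z + indicator {z. 1 < norm z} z * norm z powr (- c)" for z :: 'a
  proof (cases "norm z \<le> 1")
    case True
    then show ?thesis using kernel_le_powr[OF y c0, of "norm z"] by (simp add: indicator_def add.commute)
  next
    case False
    then have "z \<noteq> 0" by auto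
    then show ?thesis using False kernel_le_powr[of "norm z" c y] c0 by (simp add: indicator_def)
  qed
  show "AE z in lborel. norm (g z * ((norm z)\<^sup>2 + y\<^sup>2) powr (- c / 2))
      \<le> norm (B * (y powr (- c) * indicator (cball 0 1) z + indicator {z. 1 < norm z} z * norm z powr (- c)))"
    using mult_mono[OF B' k] by (intro AE_I2) (simp add: abs_mult)
qed measurable

section \<open>Convergent case: domination after symmetrisation\<close>

lemma integral_even_part:
  fixes f :: "'a::euclidean_space \<Rightarrow> real"
  assumes [measurable]: "f \<in> borel_measurable borel" and f: "integrable lborel f"
  shows "(LINT z|lborel. f z) = (LINT z|lborel. (f z + f (- z)) / 2)"
proof -
  have "integrable lborel (\<lambda>z. f (- z))"
    using integrable_affine_euclidean[of f "-1" 0] f by simp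
  moreover have "(LINT z|lborel. f z) = (LINT z|lborel. f (- z))"
    using lborel_integral_affine_euclidean[of f "-1" 0] by simp
  ultimately show ?thesis using f by simp
qed

text \<open>Both kernels are radial, so at positive parameters \<open>g\<close> may be replaced by
  its even part. Then |z|^(-c) dominates both kernels and is their common limit away from the
  origin. Symmetrising before the limit is essential, since \<open>g\<close> need not be integrable
  against |z|^(-c).\<close>

lemma tendsto_truncated_and_smooth_kernel:
  fixes g :: "'a::euclidean_space \<Rightarrow> real"
  assumes [measurable]: "g \<in> borel_measurable borel" and B: "\<And>z. \<bar>g z\<bar> \<le> B"
    and c: "real DIM('a) < c"
    and int: "integrable lborel (\<lambda>z. indicator (cball 0 1) z * (norm z powr (- c) * (g z + g (- z))))"
  obtains L where
    "((\<lambda>r. LINT z|lborel. g z * (indicator {r<..} (norm z) * norm z powr (- c))) \<longlongrightarrow> L) (at_right 0)"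
    "((\<lambda>y. LINT z|lborel. g z * ((norm z)\<^sup>2 + y\<^sup>2) powr (- c / 2)) \<longlongrightarrow> L) (at_right 0)"
proof -
  define G where "G z = (g z + g (- z)) / 2" for z
  have [measurable]: "G \<in> borel_measurable borel" unfolding G_def by measurable
  have c0: "c > 0" using c by linarith
  \<comment> \<open>The majorant uses \<open>int\<close> near the origin, and boundedness together
    with c > n in the tail.\<close>
  define W where "W z = \<bar>indicator (cball 0 1) z * (norm z powr (- c) * (g z + g (- z)))\<bar>
      + B * (indicator {z. 1 < norm z} z * norm z powr (- c))" for z
  have W: "integrable lborel W"
    unfolding W_def using int integrable_norm_powr_compl[OF c, of 1] by auto
  have GB: "\<bar>G z\<bar> \<le> B" for z
    using B[of z] B[of "-z"] by (simp add: G_def abs_le_iff field_simps)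
  have GW: "\<bar>G z\<bar> * norm z powr (- c) \<le> W z" for z
  proof (cases "norm z \<le> 1")
    case True
    have "\<bar>G z\<bar> * norm z powr (- c) \<le> (2 * \<bar>G z\<bar>) * norm z powr (- c)"
      by (intro mult_right_mono) auto
    then show ?thesis using True by (simp add: W_def G_def indicator_def abs_mult mult_ac)
  next
    case False
    then show ?thesis using GB[of z] by (simp add: W_def indicator_def mult_right_mono)
  qed
  have Teq: "(LINT z|lborel. g z * (indicator {r<..} (norm z) * norm z powr (- c))) =
      (LINT z|lborel. G z * (indicator {r<..} (norm z) * norm z powr (- c)))" if "r > 0" for r
    using integrable_truncated_kernel[of g B c r] B c that
    by (subst integral_even_part) (auto simp: G_def add_divide_distrib distrib_right)
  have Qeq: "(LINT z|lborel. g z * ((norm z)\<^sup>2 + y\<^sup>2) powr (- c / 2)) =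
      (LINT z|lborel. G z * ((norm z)\<^sup>2 + y\<^sup>2) powr (- c / 2))" if "y > 0" for y
    using integrable_smooth_kernel[of g B c y] B c that
    by (subst integral_even_part) (auto simp: G_def add_divide_distrib distrib_right)
  have "((\<lambda>r. LINT z|lborel. G z * (indicator {r<..} (norm z) * norm z powr (- c)))
      \<longlongrightarrow> (LINT z|lborel. G z * norm z powr (- c))) (at_right 0)"
  proof (rule integral_dominated_convergence_at_right_0[OF _ _ W])
    show "AE z in lborel. ((\<lambda>r. G z * (indicator {r<..} (norm z) * norm z powr (- c)))
        \<longlongrightarrow> G z * norm z powr (- c)) (at_right 0)"
    proof (intro AE_I2)
      fix z :: 'a
      show "((\<lambda>r. G z * (indicator {r<..} (norm z) * norm z powr (- c)))
        \<longlongrightarrow> G z * norm z powr (- c)) (at_right 0)"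
      proof (cases "z = 0")
        case False
        then have "\<forall>\<^sub>F r in at_right 0. r < norm z"
          by (simp add: eventually_at_right_less order_tendstoD(2)[OF tendsto_ident_at])
        then have "\<forall>\<^sub>F r in at_right 0. G z * (indicator {r<..} (norm z) * norm z powr (- c)) = G z * norm z powr (- c)"
          by eventually_elim simp
        then show ?thesis by (rule tendsto_eventually)
      qed simp
    qed
    show "AE z in lborel. \<bar>G z * (indicator {r<..} (norm z) * norm z powr (- c))\<bar> \<le> W z" for r
      using GW by (intro AE_I2) (auto simp: abs_mult indicator_def intro: order_trans[OF _ GW])
  qed measurable
  then have T: "((\<lambda>r. LINT z|lborel. g z * (indicator {r<..} (norm z) * norm z powr (- c)))
      \<longlongrightarrow> (LINT z|lborel. G z * norm z powr (- c))) (at_right 0)"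
    by (rule Lim_transform_eventually) (use Teq in \<open>auto simp: eventually_at_filter\<close>)
  have "((\<lambda>y. LINT z|lborel. G z * ((norm z)\<^sup>2 + y\<^sup>2) powr (- c / 2))
      \<longlongrightarrow> (LINT z|lborel. G z * norm z powr (- c))) (at_right 0)"
  proof (rule integral_dominated_convergence_at_right_0[OF _ _ W])
    \<comment> \<open>The origin has to be left out: there \<open>norm z powr (- c)\<close> is 0 by
      convention, whereas the smooth kernel y^(-c) blows up.\<close>
    show "AE z in lborel. ((\<lambda>y. G z * ((norm z)\<^sup>2 + y\<^sup>2) powr (- c / 2))
        \<longlongrightarrow> G z * norm z powr (- c)) (at_right 0)"
      using AE_lborel_singleton[of "0::'a"]
    proof eventually_elim
      fix z :: 'a assume z: "z \<noteq> 0"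
      have "((\<lambda>y. G z * ((norm z)\<^sup>2 + y\<^sup>2) powr (- c / 2))
        \<longlongrightarrow> G z * ((norm z)\<^sup>2 + 0\<^sup>2) powr (- c / 2)) (at_right 0)"
        using z by (intro tendsto_intros) auto
      also have "((norm z)\<^sup>2 + 0\<^sup>2) powr (- c / 2) = norm z powr (- c)"
        using powr_powr[of "norm z" 2 "- c / 2"] z by simp
      finally show "((\<lambda>y. G z * ((norm z)\<^sup>2 + y\<^sup>2) powr (- c / 2))
        \<longlongrightarrow> G z * norm z powr (- c)) (at_right 0)" .
    qed
    show "AE z in lborel. \<bar>G z * ((norm z)\<^sup>2 + y\<^sup>2) powr (- c / 2)\<bar> \<le> W z" for y
      using AE_lborel_singleton[of "0::'a"]
    proof eventually_elim
      fix z :: 'a assume z: "z \<noteq> 0"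
      have "\<bar>G z\<bar> * ((norm z)\<^sup>2 + y\<^sup>2) powr (- c / 2) \<le> \<bar>G z\<bar> * norm z powr (- c)"
        using kernel_le_powr[of "norm z" c y] z c0 by (intro mult_left_mono) auto
      then show "\<bar>G z * ((norm z)\<^sup>2 + y\<^sup>2) powr (- c / 2)\<bar> \<le> W z"
        using GW[of z] by (simp add: abs_mult)
    qed
  qed measurable
  then have Q: "((\<lambda>y. LINT z|lborel. g z * ((norm z)\<^sup>2 + y\<^sup>2) powr (- c / 2))
      \<longlongrightarrow> (LINT z|lborel. G z * norm z powr (- c))) (at_right 0)"
    by (rule Lim_transform_eventually) (use Qeq in \<open>auto simp: eventually_at_filter\<close>)
  show ?thesis using that[OF T Q] .
qed

section \<open>Borderline case: comparison through scale-invariant weights\<close>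

lemma filterlim_at_top_dyadic_increments:
  fixes T :: "real \<Rightarrow> real"
  assumes J: "J > 0" and lim: "((\<lambda>y. T (y / 2) - T y) \<longlongrightarrow> J) (at_right 0)"
    and bdd: "\<And>a. a > 0 \<Longrightarrow> \<exists>B. \<forall>y\<ge>a. \<bar>T y\<bar> \<le> B"
  shows "filterlim T at_top (at_right 0)"
proof -
  have "\<forall>\<^sub>F y in at_right 0. J / 2 < T (y / 2) - T y"
    using order_tendstoD(1)[OF lim, of "J / 2"] J by simp
  then obtain d where d: "d > 0" "\<And>y. 0 < y \<Longrightarrow> y < d \<Longrightarrow> J / 2 < T (y / 2) - T y"
    unfolding eventually_at_right_field by auto
  \<comment> \<open>Near 0 every halving gains at least J / 2. As \<open>T\<close> is not assumed
    monotone, a lower bound on a whole starting range is required, not just at one point.\<close>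
  have step: "T (2 * y) + J / 2 \<le> T y" if "0 < y" "y < d / 2" for y
    using d(2)[of "2 * y"] that by simp
  obtain B where B: "\<And>y. y \<ge> d / 4 \<Longrightarrow> \<bar>T y\<bar> \<le> B"
    using bdd[of "d / 4"] d(1) by auto
  \<comment> \<open>A point below d/4 is doubled until it reaches [d/4, d/2), where \<open>B\<close>
    applies; doubling only lowers the value of \<open>T\<close>.\<close>
  have "\<forall>y. d / 4 / 2 ^ k \<le> y \<and> y < d / 2 \<longrightarrow> - B \<le> T y" for k
  proof (induction k)
    case 0
    then show ?case using B by (auto simp: abs_le_iff minus_le_iff)
  next
    case (Suc k)
    show ?case
    proof (intro allI impI)
      fix y assume y: "d / 4 / 2 ^ Suc k \<le> y \<and> y < d / 2"
      show "- B \<le> T y"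
      proof (cases "y \<ge> d / 4")
        case True
        then show ?thesis using B[of y] by linarith
      next
        case False
        have "0 < d / 4 / 2 ^ Suc k" using d by simp
        then have "0 < y" using y by linarith
        have "- B \<le> T (2 * y)" using Suc y False by (simp add: field_simps)
        then show ?thesis using step[of y] \<open>0 < y\<close> y J by simp
      qed
    qed
  qed note low = this
  have low0: "- B \<le> T y" if "0 < y" "y < d / 2" for y
  proof -
    obtain k where "d / 4 / y < 2 ^ k" using real_arch_pow[of 2 "d / 4 / y"] by auto
    then have "d / 4 / 2 ^ k \<le> y" using that by (simp add: field_simps)
    then show ?thesis using low that by blast
  qed
  \<comment> \<open>Below d / 2^(k+1) there is room for k doublings inside (0, d/2), each worth J /
    2.\<close>
  have up: "\<forall>y. 0 < y \<and> y < d / 2 / 2 ^ k \<longrightarrow> - B + real k * (J / 2) \<le> T y" for k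
  proof (induction k)
    case 0 then show ?case using low0 by simp
  next
    case (Suc k)
    show ?case
    proof (intro allI impI)
      fix y assume y: "0 < y \<and> y < d / 2 / 2 ^ Suc k"
      have "- B + real k * (J / 2) \<le> T (2 * y)" using Suc[rule_format, of "2 * y"] y by (simp add: field_simps)
      moreover have "y < d / 2"
      proof -
        have "d / 2 / 2 ^ Suc k \<le> d / 2 / 1"
          using d one_le_power[of "2::real" "Suc k"] by (intro divide_left_mono) auto
        then show ?thesis using y by simp
      qed
      ultimately show "- B + real (Suc k) * (J / 2) \<le> T y"
        using step[of y] y by (simp add: algebra_simps)
    qed
  qed
  show ?thesis
    unfolding filterlim_at_top
  proof
    fix Z
    obtain k where "(Z + B) / (J / 2) < real k" using reals_Archimedean2 by blast
    then have k: "Z \<le> - B + real k * (J / 2)" using J by (simp add: field_simps)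
    have "0 < d / 2 / 2 ^ k" using d by simp
    then show "\<forall>\<^sub>F y in at_right 0. Z \<le> T y"
      unfolding eventually_at_right_field using up[of k] k by (intro exI[of _ "d / 2 / 2 ^ k"]) (auto intro: order_trans)
  qed
qed

text \<open>Mean value theorem for t^(-a/2) between r^2 and r^2 + 1. The two extra orders of decay
  make the difference of the kernels integrable at infinity.\<close>

lemma kernel_difference_bound:
  fixes a r :: real
  assumes "a > 0" "r > 0"
  shows "\<bar>(r\<^sup>2 + 1) powr (- a / 2) - r powr (- a)\<bar> \<le> a / 2 * r powr (- a - 2)"
proof -
  have r2: "0 < r\<^sup>2" "r\<^sup>2 < r\<^sup>2 + 1" using assms by auto
  obtain z where z: "r\<^sup>2 < z" "z < r\<^sup>2 + 1"
    "(r\<^sup>2 + 1) powr (- a / 2) - (r\<^sup>2) powr (- a / 2) = (r\<^sup>2 + 1 - r\<^sup>2) * (- a / 2 * z powr (- a / 2 - 1))"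
    using powr_diff_mvt[OF r2] by blast
  have e: "(r\<^sup>2) powr (- a / 2) = r powr (- a)" "(r\<^sup>2) powr (- a / 2 - 1) = r powr (- a - 2)"
    using powr_powr[of r 2 "- a / 2"] powr_powr[of r 2 "- a / 2 - 1"] assms by (simp_all add: algebra_simps)
  have "\<bar>(r\<^sup>2 + 1) powr (- a / 2) - r powr (- a)\<bar> = a / 2 * z powr (- a / 2 - 1)"
    using z(3) assms unfolding e by (simp add: abs_mult)
  also have "\<dots> \<le> a / 2 * (r\<^sup>2) powr (- a / 2 - 1)"
    using assms z r2 by (intro mult_left_mono powr_mono2') auto
  finally show ?thesis unfolding e .
qed

text \<open>The correction \<open>D\<close> is real, so adding it is defined for infinite
  \<open>l\<close> as well and then leaves \<open>l\<close> unchanged.\<close>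

lemma tendsto_ereal_transform:
  fixes S T :: "real \<Rightarrow> real"
  assumes "((\<lambda>y. S y - T y) \<longlongrightarrow> D) F" "((\<lambda>y. ereal (T y)) \<longlongrightarrow> l) F"
  shows "((\<lambda>y. ereal (S y)) \<longlongrightarrow> l + ereal D) F"
proof -
  have "((\<lambda>y. ereal (T y) + ereal (S y - T y)) \<longlongrightarrow> l + ereal D) F"
    using assms by (intro tendsto_add_ereal_general1 tendsto_ereal) auto
  then show ?thesis by simp
qed

text \<open>The degree \<open>b\<close> of the blow-up balances the kernel exponent
  \<open>c = n + b\<close>: dilation by y produces \<open>g (y w) / y^b\<close> against a fixed
  radial weight. Existence of a limit is not claimed, because the convergence to \<open>g0\<close>
  comes without a rate.\<close>

lemma tendsto_truncated_iff_smooth_kernel_homogeneous: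
  fixes g g0 :: "'a::euclidean_space \<Rightarrow> real" and b M B :: real and l :: ereal
  defines "c \<equiv> real DIM('a) + b"
  assumes gm [measurable]: "g \<in> borel_measurable borel" and B: "\<And>z. \<bar>g z\<bar> \<le> B"
    and b: "0 < b" and M: "\<And>z. \<bar>g z\<bar> \<le> M * norm z powr b"
    and g0m [measurable]: "g0 \<in> borel_measurable borel"
    and hom: "\<And>r w. r > 0 \<Longrightarrow> g0 (r *\<^sub>R w) = r powr b * g0 w"
    and lim: "\<And>w. ((\<lambda>y. g (y *\<^sub>R w) / y powr b) \<longlongrightarrow> g0 w) (at_right 0)"
  shows "((\<lambda>r. ereal (LINT z|lborel. g z * (indicator {r<..} (norm z) * norm z powr (- c)))) \<longlongrightarrow> l) (at_right 0) \<longleftrightarrow>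
    ((\<lambda>y. ereal (LINT z|lborel. g z * ((norm z)\<^sup>2 + y\<^sup>2) powr (- c / 2))) \<longlongrightarrow> l) (at_right 0)"
proof -
  define T where "T r = (LINT z|lborel. g z * (indicator {r<..} (norm z) * norm z powr (- c)))" for r
  define Q where "Q y = (LINT z|lborel. g z * ((norm z)\<^sup>2 + y\<^sup>2) powr (- c / 2))" for y
  have c: "real DIM('a) < c" "0 < c" using b by (auto simp: c_def)
  have M': "\<bar>g (y *\<^sub>R w) / y powr b\<bar> \<le> M * norm w powr b" if "y > 0" for y w
  proof -
    have "\<bar>g (y *\<^sub>R w)\<bar> \<le> M * (y powr b * norm w powr b)"
      using M[of "y *\<^sub>R w"] that by (simp add: powr_mult)
    then show ?thesis using that by (simp add: field_simps)
  qed
  \<comment> \<open>The bound for the rescaled \<open>g\<close> is uniform in y and so passes to the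
    blow-up, making the radial formula applicable to \<open>g0\<close>.\<close>
  have g0b: "\<bar>g0 w\<bar> \<le> M * norm w powr b" for w
    by (rule tendsto_upperbound[OF tendsto_rabs[OF lim]])
       (use M' in \<open>auto simp: eventually_at_filter\<close>)
  have c': "b + real DIM('a) = c" by (simp add: c_def)
  obtain C where C: "\<And>f. f \<in> borel_measurable borel \<Longrightarrow>
      integrable lborel (\<lambda>r. indicator {0<..} r * (f r * r powr (c - 1))) \<Longrightarrow>
      integrable lborel (\<lambda>w. g0 w * f (norm w)) \<and>
      (LINT w|lborel. g0 w * f (norm w)) = C * (LINT r|lborel. indicator {0<..} r * (f r * r powr (c - 1)))"
    by (rule integral_homogeneous_radial_signed[OF g0m hom g0b, unfolded c', OF _ c(2)]) (assumption, rule that)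
  have K: "((\<lambda>y. LINT w|lborel. g (y *\<^sub>R w) / y powr b * f (norm w)) \<longlongrightarrow>
      C * (LINT r|lborel. indicator {0<..} r * (f r * r powr (c - 1)))) (at_right 0)"
    if [measurable]: "f \<in> borel_measurable borel"
      and f: "integrable lborel (\<lambda>r. indicator {0<..} r * (f r * r powr (c - 1)))" for f
  proof -
    have "((\<lambda>y. LINT w|lborel. g (y *\<^sub>R w) / y powr b * f (norm w)) \<longlongrightarrow>
        (LINT w|lborel. g0 w * f (norm w))) (at_right 0)"
    proof (rule integral_dominated_convergence_at_right_0)
      have "(\<lambda>r. indicator {0<..} r * (r powr b * \<bar>f r\<bar> * r powr (real DIM('a) - 1))) =
          (\<lambda>r. \<bar>indicator {0<..} r * (f r * r powr (c - 1))\<bar>)"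
      proof
        fix r :: real
        show "indicator {0<..} r * (r powr b * \<bar>f r\<bar> * r powr (real DIM('a) - 1)) =
          \<bar>indicator {0<..} r * (f r * r powr (c - 1))\<bar>"
          using powr_add[of r b "real DIM('a) - 1"]
          by (simp add: indicator_def abs_mult c_def algebra_simps)
      qed
      then have "integrable lborel (\<lambda>w::'a. norm w powr b * \<bar>f (norm w)\<bar>)"
        using f by (intro integrable_radial[where f="\<lambda>r. r powr b * \<bar>f r\<bar>"]) auto
      then show "integrable lborel (\<lambda>w::'a. M * (norm w powr b * \<bar>f (norm w)\<bar>))" by simp
      show "AE w in lborel. ((\<lambda>y. g (y *\<^sub>R w) / y powr b * f (norm w)) \<longlongrightarrow> g0 w * f (norm w)) (at_right 0)"
        by (intro AE_I2 tendsto_intros lim)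
      show "AE w in lborel. \<bar>g (y *\<^sub>R w) / y powr b * f (norm w)\<bar> \<le> M * (norm w powr b * \<bar>f (norm w)\<bar>)"
        if "y > 0" for y
      proof (intro AE_I2)
        fix w :: 'a
        show "\<bar>g (y *\<^sub>R w) / y powr b * f (norm w)\<bar> \<le> M * (norm w powr b * \<bar>f (norm w)\<bar>)"
          using mult_right_mono[OF M'[OF that, of w] abs_ge_zero[of "f (norm w)"]]
          by (simp add: abs_mult mult_ac)
      qed
    qed measurable
    then show ?thesis using C[OF that] by simp
  qed
  \<comment> \<open>The Jacobian y^n and the kernel's factor y^(-c) combine to y^(-b), the
    normalisation of the blow-up.\<close>
  have scale: "(LINT z|lborel. g z * h z) = (LINT w|lborel. g (y *\<^sub>R w) / y powr b * h1 w)"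
    if [measurable]: "h \<in> borel_measurable borel" and y: "y > 0"
      and h: "\<And>w. h (y *\<^sub>R w) = y powr (- c) * h1 w" for h h1 :: "'a \<Rightarrow> real" and y
  proof -
    have e: "y ^ DIM('a) * y powr (- c) = 1 / y powr b"
      using y by (simp add: c_def powr_realpow[symmetric] powr_add[symmetric] powr_minus_divide[symmetric])
    have "(LINT z|lborel. g z * h z) = y ^ DIM('a) * (LINT w|lborel. g (y *\<^sub>R w) * (y powr (- c) * h1 w))"
      using y h by (subst lborel_integral_affine_euclidean[of _ y 0]) auto
    also have "\<dots> = (LINT w|lborel. (y ^ DIM('a) * y powr (- c)) * (g (y *\<^sub>R w) * h1 w))"
      by (simp add: mult_ac flip: integral_mult_right_zero)
    finally show ?thesis unfolding e by simp
  qed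
  have Ti: "integrable lborel (\<lambda>z. g z * (indicator {r<..} (norm z) * norm z powr (- c)))" if "r > 0" for r
    using integrable_truncated_kernel[OF gm B c(1) that] .
  have Qi: "integrable lborel (\<lambda>z. g z * ((norm z)\<^sup>2 + y\<^sup>2) powr (- c / 2))" if "y > 0" for y
    using integrable_smooth_kernel[OF gm B c(1) that] .
  have pw: "(y\<^sup>2 * a) powr (- c / 2) = y powr (- c) * a powr (- c / 2)" if "y > 0" "a \<ge> 0" for y a :: real
    using that powr_powr[of y 2 "- c / 2"] by (simp add: powr_mult)

  \<comment> \<open>Difference of the smooth and truncated kernels at unit scale. Against r^(c-1)
    each alone behaves like 1/r at infinity, which is not integrable; the difference decays like
    r^(-3).\<close>
  define k where "k r = (r\<^sup>2 + 1) powr (- c / 2) - indicator {1<..} r * r powr (- c)" for r :: real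
  have km [measurable]: "k \<in> borel_measurable borel" unfolding k_def by measurable
  have QT: "Q y - T y = (LINT w|lborel. g (y *\<^sub>R w) / y powr b * k (norm w))" if y: "y > 0" for y
  proof -
    have "Q y - T y = (LINT z|lborel. g z * (((norm z)\<^sup>2 + y\<^sup>2) powr (- c / 2) - indicator {y<..} (norm z) * norm z powr (- c)))"
      unfolding Q_def T_def right_diff_distrib using Ti Qi y
      by (intro Bochner_Integration.integral_diff[symmetric]) auto
    also have "\<dots> = (LINT w|lborel. g (y *\<^sub>R w) / y powr b * k (norm w))"
    proof (rule scale[OF _ y])
      fix w :: 'a
      have "(norm (y *\<^sub>R w))\<^sup>2 + y\<^sup>2 = y\<^sup>2 * ((norm w)\<^sup>2 + 1)"
        using y by (simp add: power_mult_distrib algebra_simps)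
      moreover have "indicator {y<..} (norm (y *\<^sub>R w)) = (indicator {1<..} (norm w) :: real)"
        using y by (auto simp: indicator_def)
      ultimately show "((norm (y *\<^sub>R w))\<^sup>2 + y\<^sup>2) powr (- c / 2) - indicator {y<..} (norm (y *\<^sub>R w)) * norm (y *\<^sub>R w) powr (- c)
          = y powr (- c) * k (norm w)"
        using y pw[of y "(norm w)\<^sup>2 + 1"] by (simp add: k_def powr_mult algebra_simps)
    qed measurable
    finally show ?thesis .
  qed
  have ki: "integrable lborel (\<lambda>r. indicator {0<..} r * (k r * r powr (c - 1)))"
  proof (rule Bochner_Integration.integrable_bound)
    show "integrable lborel (\<lambda>r. indicator {0<..1} r * r powr (c - 1) + c / 2 * (indicator {1<..} r * r powr (- 2 - 1)))"
      using integrable_powr_Ioc[of c 1] integrable_powr_Ioi[of 2 1] c by auto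
    show "AE r in lborel. norm (indicator {0<..} r * (k r * r powr (c - 1))) \<le>
        norm (indicator {0<..1} r * r powr (c - 1) + c / 2 * (indicator {1<..} r * r powr (- 2 - 1)))"
    proof (intro AE_I2)
      fix r :: real
      consider "r \<le> 0" | "0 < r" "r \<le> 1" | "1 < r" by linarith
      then show "norm (indicator {0<..} r * (k r * r powr (c - 1))) \<le>
        norm (indicator {0<..1} r * r powr (c - 1) + c / 2 * (indicator {1<..} r * r powr (- 2 - 1)))"
      proof cases
        case 2
        have "(r\<^sup>2 + 1) powr (- c / 2) \<le> 1 powr (- c / 2)"
          using c by (intro powr_mono2') auto
        then have "\<bar>k r\<bar> \<le> 1" using 2 by (simp add: k_def)
        then show ?thesis using 2 mult_right_mono[of "\<bar>k r\<bar>" 1 "r powr (c - 1)"] by (simp add: abs_mult)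
      next
        case 3
        have "\<bar>k r\<bar> \<le> c / 2 * r powr (- c - 2)"
          using kernel_difference_bound[of c r] c 3 by (simp add: k_def)
        then have "\<bar>k r\<bar> * r powr (c - 1) \<le> c / 2 * r powr (- c - 2) * r powr (c - 1)"
          by (intro mult_right_mono) auto
        also have "\<dots> = c / 2 * r powr (- 2 - 1)"
          using 3 powr_add[of r "- c - 2" "c - 1"] by simp
        finally show ?thesis using 3 c by (simp add: abs_mult)
      qed simp
    qed
  qed measurable
  have D: "((\<lambda>y. Q y - T y) \<longlongrightarrow> C * (LINT r|lborel. indicator {0<..} r * (k r * r powr (c - 1)))) (at_right 0)"
    by (rule Lim_transform_eventually[OF K[OF km ki]]) (use QT in \<open>auto simp: eventually_at_filter\<close>)

  \<comment> \<open>The shell between radii y/2 and y at unit scale. Against r^(c-1) it leaves 1/r,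
    so \<open>J\<close> below is log 2, of which only the sign matters.\<close>
  define j where "j r = indicator {1/2<..1} r * r powr (- c)" for r :: real
  have jm [measurable]: "j \<in> borel_measurable borel" unfolding j_def by measurable
  have TT: "T (y / 2) - T y = (LINT w|lborel. g (y *\<^sub>R w) / y powr b * j (norm w))" if y: "y > 0" for y
  proof -
    have "T (y / 2) - T y = (LINT z|lborel. g z * (indicator {y/2<..} (norm z) * norm z powr (- c)) -
        g z * (indicator {y<..} (norm z) * norm z powr (- c)))"
      unfolding T_def using Ti[of "y / 2"] Ti[of y] y
      by (intro Bochner_Integration.integral_diff[symmetric]) auto
    also have "\<dots> = (LINT z|lborel. g z * (indicator {y/2<..y} (norm z) * norm z powr (- c)))"
      using y by (intro Bochner_Integration.integral_cong) (auto simp: indicator_def)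
    also have "\<dots> = (LINT w|lborel. g (y *\<^sub>R w) / y powr b * j (norm w))"
    proof (rule scale[OF _ y])
      fix w :: 'a
      have "indicator {y/2<..y} (norm (y *\<^sub>R w)) = (indicator {1/2<..1} (norm w) :: real)"
        using y by (auto simp: indicator_def)
      then show "indicator {y/2<..y} (norm (y *\<^sub>R w)) * norm (y *\<^sub>R w) powr (- c) = y powr (- c) * j (norm w)"
        using y by (simp add: j_def powr_mult)
    qed measurable
    finally show ?thesis .
  qed
  have j1: "indicator {0<..} r * (j r * r powr (c - 1)) = indicator {1/2<..1} r * r powr (- 1)" for r :: real
    using powr_add[of r "- c" "c - 1"] by (simp add: j_def indicator_def)
  have half: "integrable lborel (indicator {1/2<..1} :: real \<Rightarrow> real)"
  proof -
    have e: "emeasure lborel {1/2<..1::real} = ennreal (1 - 1/2)"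
      by (rule emeasure_lborel_Ioc) simp
    show ?thesis
      by (rule integrable_real_indicator) (simp, simp only: e infinity_ennreal_def ennreal_less_top)
  qed
  have ji: "integrable lborel (\<lambda>r::real. indicator {1/2<..1} r * r powr (- 1))"
  proof (rule Bochner_Integration.integrable_bound)
    show "integrable lborel (\<lambda>r::real. 2 * indicator {1/2<..1} r :: real)"
      by (intro integrable_mult_right half)
    show "AE r::real in lborel. norm (indicator {1/2<..1} r * r powr (- 1)) \<le> norm (2 * indicator {1/2<..1} r :: real)"
      by (intro AE_I2) (auto simp: indicator_def powr_minus field_simps)
  qed measurable
  define J where "J = (LINT r|lborel. indicator {1/2<..1} r * (r :: real) powr (- 1))"
  have J: "J > 0"
  proof -
    have "(LINT r|lborel. indicator {1/2<..1} (r::real) :: real) \<le> J"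
      unfolding J_def
      by (intro integral_mono ji half) (auto simp: indicator_def powr_minus field_simps)
    then show ?thesis by simp
  qed
  have TJ: "((\<lambda>y. T (y / 2) - T y) \<longlongrightarrow> C * J) (at_right 0)"
  proof (rule Lim_transform_eventually)
    show "((\<lambda>y. LINT w|lborel. g (y *\<^sub>R w) / y powr b * j (norm w)) \<longlongrightarrow> C * J) (at_right 0)"
      using K[OF jm] ji unfolding j1 J_def by simp
  qed (use TT in \<open>auto simp: eventually_at_filter\<close>)
  \<comment> \<open>Shrinking the region of integration can only lower the integral of the absolute
    value, so the value at radius a bounds all larger radii.\<close>
  have Tb: "\<exists>B'. \<forall>r\<ge>a. \<bar>T r\<bar> \<le> B'" if a: "a > 0" for a
  proof (intro exI allI impI)
    fix r assume r: "r \<ge> a"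
    have "\<bar>T r\<bar> \<le> (LINT z|lborel. \<bar>g z * (indicator {r<..} (norm z) * norm z powr (- c))\<bar>)"
      unfolding T_def by (rule integral_abs_bound)
    also have "\<dots> \<le> (LINT z|lborel. \<bar>g z * (indicator {a<..} (norm z) * norm z powr (- c))\<bar>)"
      using Ti[of r] Ti[of a] a r
      by (intro integral_mono integrable_abs) (auto simp: abs_mult indicator_def intro!: mult_left_mono)
    finally show "\<bar>T r\<bar> \<le> (LINT z|lborel. \<bar>g z * (indicator {a<..} (norm z) * norm z powr (- c))\<bar>)" .
  qed
  have "((\<lambda>r. ereal (T r)) \<longlongrightarrow> l) (at_right 0) \<longleftrightarrow> ((\<lambda>y. ereal (Q y)) \<longlongrightarrow> l) (at_right 0)"
  proof (cases "C = 0")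
    case True
    then have QT0: "((\<lambda>y. Q y - T y) \<longlongrightarrow> 0) (at_right 0)" using D by simp
    then have TQ0: "((\<lambda>y. T y - Q y) \<longlongrightarrow> 0) (at_right 0)"
      using tendsto_minus[OF QT0] by simp
    show ?thesis
      using tendsto_ereal_transform[OF QT0, of l] tendsto_ereal_transform[OF TQ0, of l] by auto
  next
    case False
    \<comment> \<open>\<open>m\<close> is the infinity with the sign of C. Since Q - T converges, Q
      tends to \<open>m\<close> too, and uniqueness of limits makes either side of the equivalence
      say \<open>l = m\<close>.\<close>
    obtain m where m: "\<bar>m\<bar> = \<infinity>" "((\<lambda>r. ereal (T r)) \<longlongrightarrow> m) (at_right 0)"
    proof (cases "C > 0")
      case True
      then have "filterlim T at_top (at_right 0)"
        using filterlim_at_top_dyadic_increments[OF _ TJ Tb] J by simp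
      then show ?thesis using that[of \<infinity>] by (simp add: tendsto_PInfty_eq_at_top)
    next
      case neg: False
      have "filterlim (\<lambda>y. - T y) at_top (at_right 0)"
      proof (rule filterlim_at_top_dyadic_increments)
        show "- (C * J) > 0" using neg False J by (simp add: mult_less_0_iff)
        show "((\<lambda>y. - T (y / 2) - - T y) \<longlongrightarrow> - (C * J)) (at_right 0)"
          using tendsto_minus[OF TJ] by (simp add: algebra_simps)
      qed (use Tb in auto)
      then have "((\<lambda>y. ereal (- T y)) \<longlongrightarrow> \<infinity>) (at_right 0)"
        by (simp add: tendsto_PInfty_eq_at_top)
      then have "((\<lambda>y. - ereal (- T y)) \<longlongrightarrow> - \<infinity>) (at_right 0)"
        by (rule tendsto_uminus_ereal)
      then show ?thesis using that[of "- \<infinity>"] by simp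
    qed
    have "((\<lambda>y. ereal (Q y)) \<longlongrightarrow> m) (at_right 0)"
      using tendsto_ereal_transform[OF D m(2)] m(1) by (cases m) auto
    then show ?thesis using m(2) tendsto_unique trivial_limit_at_right_real by blast
  qed
  then show ?thesis unfolding T_def Q_def .
qed

section \<open>The fractional \<open>p\<close>-Laplacian\<close>

lemma AE_inner_neq_0:
  fixes a :: "'a::euclidean_space"
  assumes "a \<noteq> 0"
  shows "AE z in lborel. a \<bullet> z \<noteq> 0"
proof -
  have "closed {z. a \<bullet> z = 0}" by (rule closed_hyperplane)
  then have "{z. a \<bullet> z = 0} \<in> null_sets lborel"
    using negligible_hyperplane[of a 0] assms
    by (simp add: negligible_iff_null_sets null_sets_completion_iff)
  then show ?thesis by (rule AE_I') auto
qed

text \<open>The values of \<open>Phi p\<close> at l and -l cancel, so only two deviations from the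
  linear part remain; each is covered by \<open>E\<close>, which stands for whichever difference
  estimate fits p.\<close>

lemma even_part_Phi_le:
  assumes E: "\<And>v e. \<bar>v\<bar> = \<bar>l\<bar> \<Longrightarrow> \<bar>e\<bar> \<le> m \<Longrightarrow> \<bar>Phi p (v + e) - Phi p v\<bar> \<le> R"
    and "\<bar>t1 + l\<bar> \<le> m" "\<bar>t2 - l\<bar> \<le> m"
  shows "\<bar>Phi p t1 + Phi p t2\<bar> \<le> 2 * R"
proof -
  have "\<bar>Phi p t1 - Phi p (- l)\<bar> \<le> R" "\<bar>Phi p t2 - Phi p l\<bar> \<le> R"
    using E[of "-l" "t1 + l"] E[of l "t2 - l"] assms(2,3) by simp_all
  then show ?thesis by simp
qed

text \<open>Near 0 the even part is at most a constant times |z|^p if \<open>2 \<le> p\<close>,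
  |z|^2 |D . z|^(p-2) if p < 2 and D is nonzero, and |z|^(2(p-1)) if p < 2 and D = 0. The first two
  have degree p > sp; the third needs 2(p-1) > sp. Here D is the gradient and \<open>d\<close> has
  linear part -D.\<close>

lemma integrable_even_part_Phi:
  fixes d :: "'a::euclidean_space \<Rightarrow> real" and D :: 'a
  assumes s: "0 < s" "s < 1" and p: "1 < p" and M: "M \<ge> 0"
    and [measurable]: "d \<in> borel_measurable borel"
    and d: "\<And>z. \<bar>d z + D \<bullet> z\<bar> \<le> M * (norm z)\<^sup>2"
    and nd: "p \<le> 2 / (2 - s) \<Longrightarrow> D \<noteq> 0"
  shows "integrable lborel (\<lambda>z. indicator (cball 0 1) z *
    (norm z powr (- (real DIM('a) + s * p)) * (Phi p (d z) + Phi p (d (- z)))))"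
proof -
  define c where "c = real DIM('a) + s * p"
  have [measurable]: "Phi p \<in> borel_measurable borel"
    using continuous_on_Phi[OF p] by (rule borel_measurable_continuous_onI)
  have sp: "s * p < p" using s p by simp
  have d': "\<bar>d (- z) - D \<bullet> z\<bar> \<le> M * (norm z)\<^sup>2" for z using d[of "-z"] by simp
  have fin: "integrable lborel (\<lambda>z. indicator (cball 0 1) z *
      (norm z powr (- c) * (Phi p (d z) + Phi p (d (- z)))))"
    if int: "integrable lborel (\<lambda>z. indicator (cball 0 1) z * norm z powr (b - c) * h z)"
      and C: "AE z in lborel. norm z \<le> 1 \<longrightarrow> \<bar>Phi p (d z) + Phi p (d (- z))\<bar> \<le> C * (norm z powr b * h z)"
    for b C h
  proof (rule Bochner_Integration.integrable_bound)
    show "integrable lborel (\<lambda>z. C * (indicator (cball 0 1) z * norm z powr (b - c) * h z))"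
      using int by simp
    show "AE z in lborel. norm (indicator (cball 0 1) z * (norm z powr (- c) * (Phi p (d z) + Phi p (d (- z))))) \<le>
        norm (C * (indicator (cball 0 1) z * norm z powr (b - c) * h z))"
      using C
    proof eventually_elim
      case (elim z)
      show ?case
      proof (cases "norm z \<le> 1")
        case True
        then have "norm z powr (- c) * \<bar>Phi p (d z) + Phi p (d (- z))\<bar> \<le> norm z powr (- c) * (C * (norm z powr b * h z))"
          using elim by (intro mult_left_mono) auto
        also have "\<dots> = C * (norm z powr (b - c) * h z)"
          using powr_add[of "norm z" "- c" b] by (simp add: mult_ac)
        also have "\<dots> \<le> \<bar>C * (norm z powr (b - c) * h z)\<bar>" by simp
        finally show ?thesis using True by (simp add: abs_mult)
      qed simp
    qed
  qed measurable
  consider "2 \<le> p" | "p < 2" "D \<noteq> 0" | "p < 2" "D = 0" by linarith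
  then show ?thesis
  proof cases
    case 1
    \<comment> \<open>Inside the unit ball the quadratic error is at most M \<open>norm z\<close>,
      so the linear part and its perturbation are both bounded by A \<open>norm z\<close>.\<close>
    define A where "A = norm D + M"
    have "\<bar>Phi p (d z) + Phi p (d (- z))\<bar> \<le> 2 * ((p - 1) * M * A powr (p - 2)) * norm z powr p"
      if z: "norm z \<le> 1" for z
    proof (cases "z = 0")
      case True
      then have "d z = 0" "d (- z) = 0" using d[of 0] by auto
      then show ?thesis using True by (simp add: Phi_def)
    next
      case False
      have zz: "(norm z)\<^sup>2 \<le> norm z" using z by (simp add: power2_eq_square mult_left_le)
      have "\<bar>Phi p (d z) + Phi p (d (- z))\<bar> \<le> 2 * ((p - 1) * (M * (norm z)\<^sup>2) * (A * norm z) powr (p - 2))"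
      proof (rule even_part_Phi_le[OF _ d d'])
        fix v e assume v: "\<bar>v\<bar> = \<bar>D \<bullet> z\<bar>" and e: "\<bar>e\<bar> \<le> M * (norm z)\<^sup>2"
        have "\<bar>e\<bar> \<le> M * norm z" using e mult_left_mono[OF zz M] by linarith
        moreover have "\<bar>v\<bar> \<le> norm D * norm z" using v Cauchy_Schwarz_ineq2[of D z] by simp
        moreover have "0 \<le> M * norm z" using M by simp
        ultimately have mx: "max \<bar>v + e\<bar> \<bar>v\<bar> \<le> A * norm z"
          by (simp add: A_def distrib_right)
        have "\<bar>Phi p (v + e) - Phi p v\<bar> \<le> (p - 1) * \<bar>e\<bar> * max \<bar>v + e\<bar> \<bar>v\<bar> powr (p - 2)"
          using Phi_diff_le_max[OF 1, of "v + e" v] by simp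
        also have "\<dots> \<le> (p - 1) * (M * (norm z)\<^sup>2) * (A * norm z) powr (p - 2)"
          using 1 e mx M by (intro mult_mono powr_mono2) auto
        finally show "\<bar>Phi p (v + e) - Phi p v\<bar> \<le> (p - 1) * (M * (norm z)\<^sup>2) * (A * norm z) powr (p - 2)" .
      qed
      also have "\<dots> = 2 * ((p - 1) * M * A powr (p - 2)) * ((norm z)\<^sup>2 * norm z powr (p - 2))"
        using M by (simp add: powr_mult A_def mult_ac)
      also have "(norm z)\<^sup>2 * norm z powr (p - 2) = norm z powr p"
        using False powr_add[of "norm z" 2 "p - 2"] by simp
      finally show ?thesis .
    qed
    moreover have "integrable lborel (\<lambda>z::'a. indicator (cball 0 1) z * norm z powr (p - c))"
      by (rule integrable_norm_powr_cball) (use sp in \<open>auto simp: c_def\<close>)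
    ultimately show ?thesis unfolding c_def[symmetric] using fin[of p "\<lambda>_. 1" "2 * ((p - 1) * M * A powr (p - 2))"] by simp
  next
    case 2
    \<comment> \<open>On the hyperplane D . z = 0 the convention \<open>0 powr (p - 2) = 0\<close>
      would make the right-hand side vanish, so the estimate is only stated off this null
      set.\<close>
    have "\<bar>Phi p (d z) + Phi p (d (- z))\<bar> \<le> 8 * M * (norm z powr 2 * \<bar>D \<bullet> z\<bar> powr (p - 2))"
      if z: "D \<bullet> z \<noteq> 0" for z
    proof -
      have "z \<noteq> 0" using z by auto
      have "\<bar>Phi p (d z) + Phi p (d (- z))\<bar> \<le> 2 * (4 * (M * (norm z)\<^sup>2) * \<bar>D \<bullet> z\<bar> powr (p - 2))"
      proof (rule even_part_Phi_le[OF _ d d'])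
        fix v e assume v: "\<bar>v\<bar> = \<bar>D \<bullet> z\<bar>" and e: "\<bar>e\<bar> \<le> M * (norm z)\<^sup>2"
        have "\<bar>Phi p (v + e) - Phi p v\<bar> \<le> 4 * \<bar>e\<bar> * \<bar>v\<bar> powr (p - 2)"
          using Phi_diff_le_singular[of p v e] p 2 v z by auto
        also have "\<dots> \<le> 4 * (M * (norm z)\<^sup>2) * \<bar>D \<bullet> z\<bar> powr (p - 2)"
          unfolding v using e by (intro mult_right_mono) auto
        finally show "\<bar>Phi p (v + e) - Phi p v\<bar> \<le> 4 * (M * (norm z)\<^sup>2) * \<bar>D \<bullet> z\<bar> powr (p - 2)" .
      qed
      then show ?thesis using \<open>z \<noteq> 0\<close> by (simp add: mult_ac)
    qed
    then have "AE z in lborel. norm z \<le> 1 \<longrightarrow>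
        \<bar>Phi p (d z) + Phi p (d (- z))\<bar> \<le> 8 * M * (norm z powr 2 * \<bar>D \<bullet> z\<bar> powr (p - 2))"
      using AE_inner_neq_0[OF 2(2)] by (auto elim!: eventually_mono)
    moreover have "integrable lborel (\<lambda>z. indicator (cball 0 1) z * norm z powr (2 - c) * \<bar>D \<bullet> z\<bar> powr (p - 2))"
      by (rule integrable_norm_powr_inner_powr_cball) (use sp p 2 in \<open>auto simp: c_def\<close>)
    ultimately show ?thesis unfolding c_def[symmetric] using fin[of 2 "\<lambda>z. \<bar>D \<bullet> z\<bar> powr (p - 2)" "8 * M"] by simp
  next
    case 3
    \<comment> \<open>With D = 0, \<open>nd\<close> rules out smaller and equal exponents; the
      strict inequality is precisely sp < 2(p-1).\<close>
    have "2 / (2 - s) < p" using nd 3 by fastforce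
    then have big: "s * p < 2 * (p - 1)" using s by (simp add: field_simps)
    have "\<bar>Phi p (d z) + Phi p (d (- z))\<bar> \<le> 4 * M powr (p - 1) * norm z powr (2 * (p - 1))" for z
    proof -
      have "\<bar>Phi p (d z) + Phi p (d (- z))\<bar> \<le> 2 * (2 * (M * (norm z)\<^sup>2) powr (p - 1))"
      proof (rule even_part_Phi_le[OF _ d d'])
        fix v e assume e: "\<bar>e\<bar> \<le> M * (norm z)\<^sup>2"
        have "\<bar>Phi p (v + e) - Phi p v\<bar> \<le> 2 * \<bar>e\<bar> powr (p - 1)"
          using Phi_hoelder[of p "v + e" v] p 3 by simp
        also have "\<dots> \<le> 2 * (M * (norm z)\<^sup>2) powr (p - 1)"
          using e p by (intro mult_left_mono powr_mono2) auto
        finally show "\<bar>Phi p (v + e) - Phi p v\<bar> \<le> 2 * (M * (norm z)\<^sup>2) powr (p - 1)" .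
      qed
      also have "(M * (norm z)\<^sup>2) powr (p - 1) = M powr (p - 1) * norm z powr (2 * (p - 1))"
        using M powr_powr[of "norm z" 2 "p - 1"] by (cases "z = 0") (simp_all add: powr_mult)
      finally show ?thesis by simp
    qed
    moreover have "integrable lborel (\<lambda>z::'a. indicator (cball 0 1) z * norm z powr (2 * (p - 1) - c))"
      by (rule integrable_norm_powr_cball) (use big in \<open>auto simp: c_def\<close>)
    ultimately show ?thesis unfolding c_def[symmetric] using fin[of "2 * (p - 1)" "\<lambda>_. 1" "4 * M powr (p - 1)"] by simp
  qed
qed

section \<open>Passage from the operators to the two kernel integrals\<close>

lemma truncated_integral_frac_p_integrand:
  fixes u :: "'a::euclidean_space \<Rightarrow> real"
  assumes [measurable]: "u \<in> borel_measurable borel" "Phi p \<in> borel_measurable borel"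
  shows "truncated_integral (frac_p_integrand s p u x) x r =
    (LINT z|lborel. Phi p (u x - u (x + z)) * (indicator {r<..} (norm z) * norm z powr (- (real DIM('a) + s * p))))"
proof -
  have "truncated_integral (frac_p_integrand s p u x) x r =
    (LINT y|lborel. indicator {r<..} (norm (x - y)) * (Phi p (u x - u y) / norm (x - y) powr (real DIM('a) + s * p)))"
    unfolding truncated_integral_def frac_p_integrand_def set_lebesgue_integral_def
    by (intro Bochner_Integration.integral_cong) (auto simp: indicator_def)
  also have "\<dots> = (LINT z|lborel. indicator {r<..} (norm z) * (Phi p (u x - u (x + z)) / norm z powr (real DIM('a) + s * p)))"
    by (subst lborel_integral_affine_euclidean[of _ 1 x]) auto
  also have "\<dots> = (LINT z|lborel. Phi p (u x - u (x + z)) * (indicator {r<..} (norm z) * norm z powr (- (real DIM('a) + s * p))))"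
    by (intro Bochner_Integration.integral_cong) (simp_all only: powr_minus_divide, simp_all)
  finally show ?thesis .
qed

text \<open>The factor \<open>y powr (s * p)\<close> of the kernel cancels against the divisor,
  leaving the smooth kernel and a constant independent of y.\<close>

lemma extension_quotient_eq:
  fixes u :: "'a::euclidean_space \<Rightarrow> real"
  assumes [measurable]: "u \<in> borel_measurable borel" "Phi p \<in> borel_measurable borel" and y: "y > 0"
  shows "extension_quotient s p u x y =
    Gamma ((real DIM('a) + s * p) / 2) / (pi powr (real DIM('a) / 2) * Gamma (s * p / 2)) *
    (LINT z|lborel. Phi p (u x - u (x + z)) * ((norm z)\<^sup>2 + y\<^sup>2) powr (- (real DIM('a) + s * p) / 2))"
    (is "_ = ?k * (LINT z|lborel. ?f z)")
proof -
  have "extension s p (\<lambda>\<xi>. Phi p (u x - u \<xi>)) x y =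
    (LINT z|lborel. ext_kernel s p (- z) y * Phi p (u x - u (x + z)))"
    unfolding extension_def
    by (subst lborel_integral_affine_euclidean[of _ 1 x]) (auto simp: ext_kernel_def)
  also have "\<dots> = (LINT z|lborel. (?k * y powr (s * p)) * ?f z)"
  proof (intro Bochner_Integration.integral_cong refl)
    fix z :: 'a
    have "((norm z)\<^sup>2 + y\<^sup>2) powr (- (real DIM('a) + s * p) / 2) =
        1 / ((norm z)\<^sup>2 + y\<^sup>2) powr ((real DIM('a) + s * p) / 2)"
      using powr_minus_divide[of "(norm z)\<^sup>2 + y\<^sup>2" "(real DIM('a) + s * p) / 2"]
      by (simp only: minus_divide_left)
    then show "ext_kernel s p (- z) y * Phi p (u x - u (x + z)) = (?k * y powr (s * p)) * ?f z"
      by (simp add: ext_kernel_def)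
  qed
  also have "\<dots> = (?k * y powr (s * p)) * (LINT z|lborel. ?f z)"
    by (rule integral_mult_right_zero)
  finally show ?thesis using y unfolding extension_quotient_def by simp
qed

lemma C2b_borel_measurable:
  assumes "C2b u" shows "u \<in> borel_measurable borel"
proof (rule borel_measurable_continuous_onI, rule continuous_at_imp_continuous_on, rule ballI)
  show "isCont u x" for x
    using C2b_GDERIV[OF assms, of x] unfolding gderiv_def by (rule has_derivative_continuous)
qed

lemma truncated_and_smooth_kernel_limits_C2b:
  fixes u :: "'a::euclidean_space \<Rightarrow> real" and x0 :: 'a
  defines "c s p \<equiv> real DIM('a) + s * p"
  assumes s: "0 < s" "s < 1" and p: "1 < p" and u: "C2b u"
    and nd: "p < 2 / (2 - s) \<Longrightarrow> gradient u x0 \<noteq> 0"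
  defines "T \<equiv> \<lambda>r. LINT z|lborel. Phi p (u x0 - u (x0 + z)) * (indicator {r<..} (norm z) * norm z powr (- c s p))"
    and "Q \<equiv> \<lambda>y. LINT z|lborel. Phi p (u x0 - u (x0 + z)) * ((norm z)\<^sup>2 + y\<^sup>2) powr (- c s p / 2)"
  shows "((\<lambda>r. ereal (T r)) \<longlongrightarrow> l) (at_right 0) \<longleftrightarrow> ((\<lambda>y. ereal (Q y)) \<longlongrightarrow> l) (at_right 0)"
    and "p \<noteq> 2 / (2 - s) \<or> gradient u x0 \<noteq> 0 \<Longrightarrow> \<exists>L. (T \<longlongrightarrow> L) (at_right 0)"
proof -
  define d where "d z = u x0 - u (x0 + z)" for z
  define g where "g z = Phi p (d z)" for z
  note [measurable] = C2b_borel_measurable[OF u]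
  have Phi_m [measurable]: "Phi p \<in> borel_measurable borel"
    using continuous_on_Phi[OF p] by (rule borel_measurable_continuous_onI)
  have dm [measurable]: "d \<in> borel_measurable borel" unfolding d_def by measurable
  have gm: "g \<in> borel_measurable borel" unfolding g_def by measurable
  obtain B where B: "\<And>x. \<bar>u x\<bar> \<le> B"
    using u unfolding C2b_def bounded_iff by auto
  have gB: "\<bar>g z\<bar> \<le> (2 * B) powr (p - 1)" for z
  proof -
    have "\<bar>d z\<bar> \<le> 2 * B" using B[of x0] B[of "x0 + z"] by (simp add: d_def)
    then show ?thesis unfolding g_def abs_Phi using p by (intro powr_mono2) auto
  qed
  obtain M H where M: "M \<ge> 0"
    and taylor: "\<And>z. \<bar>u (x0 + z) - u x0 - gradient u x0 \<bullet> z\<bar> \<le> M * (norm z)\<^sup>2"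
    and H: "continuous_on UNIV H" "\<And>r w. H (r *\<^sub>R w) = r\<^sup>2 * H w"
    and Hlim: "\<And>w. ((\<lambda>y. (u (x0 + y *\<^sub>R w) - u x0 - y * (gradient u x0 \<bullet> w)) / y\<^sup>2) \<longlongrightarrow> H w) (at_right 0)"
    by (rule C2b_taylor[OF u, of x0]) (rule that)
  have dM: "\<bar>d z + gradient u x0 \<bullet> z\<bar> \<le> M * (norm z)\<^sup>2" for z
    using taylor[of z] unfolding d_def by linarith
  have Tg: "T = (\<lambda>r. LINT z|lborel. g z * (indicator {r<..} (norm z) * norm z powr (- c s p)))"
    and Qg: "Q = (\<lambda>y. LINT z|lborel. g z * ((norm z)\<^sup>2 + y\<^sup>2) powr (- c s p / 2))"
    by (simp_all add: T_def Q_def g_def d_def)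
  have conv: "\<exists>L. (T \<longlongrightarrow> L) (at_right 0) \<and> (Q \<longlongrightarrow> L) (at_right 0)"
    if nb: "p \<noteq> 2 / (2 - s) \<or> gradient u x0 \<noteq> 0"
  proof -
    have int: "integrable lborel (\<lambda>z. indicator (cball 0 1) z * (norm z powr (- c s p) * (g z + g (- z))))"
      unfolding g_def c_def
      \<comment> \<open>\<open>nd\<close> covers p < 2/(2-s) and \<open>nb\<close> the case of
        equality; together they give a nonzero gradient whenever
        \<open>p \<le> 2 / (2 - s)\<close>.\<close>
      by (rule integrable_even_part_Phi[OF s p M dm dM]) (use nd nb in linarith)
    have dim: "real DIM('a) < c s p" using s p by (simp add: c_def)
    obtain L where "(T \<longlongrightarrow> L) (at_right 0)" "(Q \<longlongrightarrow> L) (at_right 0)"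
      by (rule tendsto_truncated_and_smooth_kernel[OF gm gB dim int, folded Tg Qg]) (rule that)
    then show ?thesis by blast
  qed
  then show "\<exists>L. (T \<longlongrightarrow> L) (at_right 0)" if "p \<noteq> 2 / (2 - s) \<or> gradient u x0 \<noteq> 0"
    using that by blast
  show "((\<lambda>r. ereal (T r)) \<longlongrightarrow> l) (at_right 0) \<longleftrightarrow> ((\<lambda>y. ereal (Q y)) \<longlongrightarrow> l) (at_right 0)"
  proof (cases "p \<noteq> 2 / (2 - s) \<or> gradient u x0 \<noteq> 0")
    case True
    then obtain L where L: "(T \<longlongrightarrow> L) (at_right 0)" "(Q \<longlongrightarrow> L) (at_right 0)"
      using conv by blast
    show ?thesis
      using L[THEN tendsto_ereal] tendsto_unique trivial_limit_at_right_real by blast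
  next
    case False
    then have grad: "gradient u x0 = 0" and pc: "p = 2 / (2 - s)" by auto
    \<comment> \<open>At this exponent \<open>Phi p\<close> of a quadratic form has exactly the
      order sp of the kernel.\<close>
    have sp: "s * p = 2 * (p - 1)" using s unfolding pc by (simp add: field_simps)
    \<comment> \<open>As the gradient vanishes, the increment in \<open>g (y *\<^sub>R w)\<close> is
      -y^2 H(w) to leading order, and \<open>Phi p\<close> has degree p - 1.\<close>
    define g0 where "g0 w = Phi p (- H w)" for w
    show ?thesis unfolding Tg Qg c_def
    proof (rule tendsto_truncated_iff_smooth_kernel_homogeneous[OF gm gB])
      show "0 < s * p" using s p by simp
      have [measurable]: "H \<in> borel_measurable borel" using H(1) by (rule borel_measurable_continuous_onI)
      show "g0 \<in> borel_measurable borel" unfolding g0_def by measurable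
      show "\<bar>g z\<bar> \<le> M powr (p - 1) * norm z powr (s * p)" for z
      proof -
        have "\<bar>g z\<bar> \<le> (M * (norm z)\<^sup>2) powr (p - 1)"
          unfolding g_def abs_Phi using dM[of z] p by (intro powr_mono2) (auto simp: grad)
        also have "\<dots> = M powr (p - 1) * norm z powr (s * p)"
          unfolding sp using M powr_powr[of "norm z" 2 "p - 1"] by (cases "z = 0") (simp_all add: powr_mult)
        finally show ?thesis .
      qed
      have sq: "(r\<^sup>2) powr (p - 1) = r powr (s * p)" if "r > 0" for r
        unfolding sp using that powr_powr[of r 2 "p - 1"] by simp
      show "g0 (r *\<^sub>R w) = r powr (s * p) * g0 w" if "r > 0" for r w
        using Phi_mult[of "r\<^sup>2" p "- H w"] that by (simp add: g0_def H(2) sq)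
      show "((\<lambda>y. g (y *\<^sub>R w) / y powr (s * p)) \<longlongrightarrow> g0 w) (at_right 0)" for w
      proof (rule Lim_transform_eventually)
        have "((\<lambda>y. - ((u (x0 + y *\<^sub>R w) - u x0) / y\<^sup>2)) \<longlongrightarrow> - H w) (at_right 0)"
          using tendsto_minus[OF Hlim[of w]] by (simp add: grad)
        moreover have "isCont (Phi p) (- H w)"
          using continuous_on_Phi[OF p] by (simp add: continuous_on_eq_continuous_at)
        ultimately show "((\<lambda>y. Phi p (- ((u (x0 + y *\<^sub>R w) - u x0) / y\<^sup>2))) \<longlongrightarrow> g0 w) (at_right 0)"
          unfolding g0_def by (rule isCont_tendsto_compose[rotated])
        have "Phi p (- ((u (x0 + y *\<^sub>R w) - u x0) / y\<^sup>2)) = g (y *\<^sub>R w) / y powr (s * p)" if "y > 0" for y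
        proof -
          have "g (y *\<^sub>R w) = Phi p (y\<^sup>2 * (- ((u (x0 + y *\<^sub>R w) - u x0) / y\<^sup>2)))"
            using that by (simp add: g_def d_def)
          also have "\<dots> = y powr (s * p) * Phi p (- ((u (x0 + y *\<^sub>R w) - u x0) / y\<^sup>2))"
            using that by (subst Phi_mult) (simp_all add: sq)
          finally show ?thesis using that by simp
        qed
        then show "\<forall>\<^sub>F y in at_right 0. Phi p (- ((u (x0 + y *\<^sub>R w) - u x0) / y\<^sup>2)) = g (y *\<^sub>R w) / y powr (s * p)"
          by (auto simp: eventually_at_filter)
      qed
    qed
  qed
qed

lemma tendsto_ereal_cmult_iff:
  fixes f :: "real \<Rightarrow> real"
  assumes "k > 0"
  shows "((\<lambda>y. ereal (k * f y)) \<longlongrightarrow> ereal k * l) F \<longleftrightarrow> ((\<lambda>y. ereal (f y)) \<longlongrightarrow> l) F"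
proof
  assume "((\<lambda>y. ereal (f y)) \<longlongrightarrow> l) F"
  then show "((\<lambda>y. ereal (k * f y)) \<longlongrightarrow> ereal k * l) F"
    using tendsto_cmult_ereal[of "ereal k" "\<lambda>y. ereal (f y)" l F] by simp
next
  assume "((\<lambda>y. ereal (k * f y)) \<longlongrightarrow> ereal k * l) F"
  then have "((\<lambda>y. ereal (1 / k) * ereal (k * f y)) \<longlongrightarrow> ereal (1 / k) * (ereal k * l)) F"
    by (intro tendsto_cmult_ereal) auto
  moreover have "ereal (1 / k) * (ereal k * l) = l"
    using assms by (cases l) auto
  ultimately show "((\<lambda>y. ereal (f y)) \<longlongrightarrow> l) F" using assms by simp
qed

text \<open>\<open>Lim\<close> is meaningful only where a limit exists, and in the borderline case
  with vanishing gradient existence is not guaranteed. Hence existence is transferred both ways, the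
  identity is read in \<open>ereal\<close> so as to include infinite values, and finiteness is
  asserted outside that case.\<close>

theorem theorem3p1:
  fixes s p :: real
    and C1 :: "nat \<Rightarrow> real \<Rightarrow> real \<Rightarrow> real"
    and u :: "real ^ 'n \<Rightarrow> real"
    and x0 :: "real ^ 'n"
  assumes "0 < s" "s < 1"
    and "1 < p"
    and "0 < C1 CARD('n) s p"
    and "C2b u"
    and "p < 2 / (2 - s) \<Longrightarrow> gradient u x0 \<noteq> 0"
  shows
    "(pv_exists (frac_p_integrand s p u x0) x0 \<longleftrightarrow>
        (\<exists>L::ereal. ((\<lambda>y. ereal (extension_quotient s p u x0 y)) \<longlongrightarrow> L) (at_right 0))) \<and>
     (pv_exists (frac_p_integrand s p u x0) x0 \<longrightarrow>
        frac_p_laplacian C1 s p u x0 =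
          ereal (C3 C1 CARD('n) s p) *
          Lim (at_right 0) (\<lambda>y. ereal (extension_quotient s p u x0 y))) \<and>
     (p \<noteq> 2 / (2 - s) \<or> gradient u x0 \<noteq> 0 \<longrightarrow>
        pv_exists (frac_p_integrand s p u x0) x0 \<and> \<bar>frac_p_laplacian C1 s p u x0\<bar> \<noteq> \<infinity>)"
proof -
  define T where "T r = truncated_integral (frac_p_integrand s p u x0) x0 r" for r
  define E where "E y = extension_quotient s p u x0 y" for y
  define c where "c = real DIM(real ^ 'n) + s * p"
  define k where "k = Gamma (c / 2) / (pi powr (real DIM(real ^ 'n) / 2) * Gamma (s * p / 2))"
  define Q where "Q y = (LINT z|lborel. Phi p (u x0 - u (x0 + z)) * ((norm z)\<^sup>2 + y\<^sup>2) powr (- c / 2))" for y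
  have sp: "0 < s * p" using assms by simp
  have k: "k > 0" unfolding k_def using sp assms(1,3)
    by (intro divide_pos_pos mult_pos_pos Gamma_real_pos) (auto simp: c_def add_nonneg_pos)
  have um: "u \<in> borel_measurable borel" using assms(5) by (rule C2b_borel_measurable)
  have Pm: "Phi p \<in> borel_measurable borel"
    using continuous_on_Phi[OF assms(3)] by (rule borel_measurable_continuous_onI)
  have Teq: "T r = (LINT z|lborel. Phi p (u x0 - u (x0 + z)) * (indicator {r<..} (norm z) * norm z powr (- c)))" for r
    unfolding T_def c_def using truncated_integral_frac_p_integrand[OF um Pm] by auto
  have Eeq: "E y = k * Q y" if "y > 0" for y
    unfolding E_def k_def Q_def c_def using extension_quotient_eq[OF um Pm that] by simp
  note lims = truncated_and_smooth_kernel_limits_C2b[OF assms(1,2,3,5,6), folded c_def, folded Teq Q_def]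
  have TE: "((\<lambda>r. ereal (T r)) \<longlongrightarrow> l) (at_right 0) \<longleftrightarrow> ((\<lambda>y. ereal (E y)) \<longlongrightarrow> ereal k * l) (at_right 0)" for l
  proof -
    have "((\<lambda>y. ereal (E y)) \<longlongrightarrow> ereal k * l) (at_right 0) \<longleftrightarrow>
        ((\<lambda>y. ereal (k * Q y)) \<longlongrightarrow> ereal k * l) (at_right 0)"
      by (intro filterlim_cong) (use Eeq in \<open>auto simp: eventually_at_filter\<close>)
    then show ?thesis using lims(1)[of l] tendsto_ereal_cmult_iff[OF k] by simp
  qed
  have ex: "pv_exists (frac_p_integrand s p u x0) x0 \<longleftrightarrow> (\<exists>L. ((\<lambda>y. ereal (E y)) \<longlongrightarrow> L) (at_right 0))"
  proof
    assume "\<exists>L. ((\<lambda>y. ereal (E y)) \<longlongrightarrow> L) (at_right 0)"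
    then obtain L where L: "((\<lambda>y. ereal (E y)) \<longlongrightarrow> L) (at_right 0)" ..
    \<comment> \<open>As k is positive and finite, every extended real is k times another, so each
      limit of \<open>E\<close> arises from one of \<open>T\<close>.\<close>
    moreover have "L = ereal k * (ereal (1 / k) * L)" using k by (cases L) auto
    ultimately show "pv_exists (frac_p_integrand s p u x0) x0"
      unfolding pv_exists_def T_def[symmetric] using TE by metis
  qed (use TE in \<open>auto simp: pv_exists_def T_def[symmetric]\<close>)
  have val: "frac_p_laplacian C1 s p u x0 = ereal (C1 CARD('n) s p) * l"
    if "((\<lambda>r. ereal (T r)) \<longlongrightarrow> l) (at_right 0)" for l
    using tendsto_Lim[OF _ that]
    by (simp add: frac_p_laplacian_def pv_integral_def T_def[symmetric])
  \<comment> \<open>\<open>k\<close> is the normalising constant of the extension kernel, and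
    \<open>C3\<close> is \<open>C1\<close> divided by it.\<close>
  have C3: "C3 C1 CARD('n) s p * k = C1 CARD('n) s p"
  proof -
    have "Gamma (c / 2) > 0" "Gamma (s * p / 2) > 0"
      using sp assms by (auto intro!: Gamma_real_pos simp: c_def add_nonneg_pos)
    then show ?thesis by (simp add: C3_def k_def c_def)
  qed
  have eq: "frac_p_laplacian C1 s p u x0 = ereal (C3 C1 CARD('n) s p) * Lim (at_right 0) (\<lambda>y. ereal (E y))"
    if pv: "pv_exists (frac_p_integrand s p u x0) x0"
  proof -
    obtain l where l: "((\<lambda>r. ereal (T r)) \<longlongrightarrow> l) (at_right 0)"
      using pv unfolding pv_exists_def T_def[symmetric] by blast
    have "Lim (at_right 0) (\<lambda>y. ereal (E y)) = ereal k * l"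
      using l TE by (intro tendsto_Lim) auto
    then have "ereal (C3 C1 CARD('n) s p) * Lim (at_right 0) (\<lambda>y. ereal (E y)) = ereal (C3 C1 CARD('n) s p * k) * l"
      by (metis mult.assoc times_ereal.simps(1))
    then show ?thesis using val[OF l] C3 by simp
  qed
  have fin: "pv_exists (frac_p_integrand s p u x0) x0 \<and> \<bar>frac_p_laplacian C1 s p u x0\<bar> \<noteq> \<infinity>"
    if nb: "p \<noteq> 2 / (2 - s) \<or> gradient u x0 \<noteq> 0"
  proof -
    obtain L where "(T \<longlongrightarrow> L) (at_right 0)" using lims(2)[OF _ nb] by blast
    then have L: "((\<lambda>r. ereal (T r)) \<longlongrightarrow> ereal L) (at_right 0)" by (rule tendsto_ereal)
    then show ?thesis using val[OF L] unfolding pv_exists_def T_def[symmetric] by auto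
  qed
  show ?thesis using ex eq fin unfolding E_def by blast
qed

end
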